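(* For any integer $n\ge0$, $$\widetilde{A}_n(q,t)=\sum_{(\alpha,f)\in\widetilde{\mathtt{Code}}_n}q^{\mathrm{inv}(\alpha)}t^{\mathrm{ind}(\alpha,f)+1}=\sum_{(\alpha,f)\in\widetilde{\mathtt{Code}}_n}q^{\mathrm{maj}(\alpha)}t^{\mathrm{ind}(\alpha,f)+1},$$ where $\mathrm{inv}(\alpha)$ and $\mathrm{maj}(\alpha)$ are the inversion number and major index of $\alpha$ as a word over $\{0<1<2<\cdots<\infty\}$.
   Context: For a word $w=w_1\cdots w_n$ over a totally ordered set: $\mathrm{DES}(w)=\{i\in[n-1]:w_i>w_{i+1}\}$, $\mathrm{maj}(w)=\sum_{i\in\mathrm{DES}(w)}i$, $\mathrm{inv}(w)=|\{(i,j):1\le i<j\le n,\ w_i>w_j\}|$. For $\sigma\in\mathfrak{S}_n$, $\mathrm{exc}(\sigma)=|\{i:\sigma_i>i\}|$. For $k\ge1$ put $A_k(q,t)=\sum_{\sigma\in\mathfrak{S}_k}q^{\mathrm{maj}(\sigma)-\mathrm{exc}(\sigma)}t^{\mathrm{exc}(\sigma)}$. The $q$-binomial Eulerian polynomial is $$\widetilde A_n(q,t)=1+t\sum_{k=1}^n\begin{bmatrix}n\\k\end{bmatrix}_qA_k(q,t),$$ where $\begin{bmatrix}n\\k\end{bmatrix}_q=\frac{[n]_q!}{[k]_q![n-k]_q!}$, $[m]_q!=\prod_{i=1}^m[i]_q$, $[i]_q=1+q+\cdots+q^{i-1}$. An extended code of length $n$ is a pair $(\alpha,f)$ where $\alpha=\alpha_1\cdots\alpha_n$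 is a sequence over $\{0,1,2,\dots\}\cup\{\infty\}$ such that, with $m(\alpha)$ the maximum finite number appearing in $\alpha$ (taken as $0$ if there is none), each $k\in\{1,\dots,m(\alpha)\}$ occurs at least twice in $\alpha$; and for each such $k$ exactly one occurrence of $k$ other than the first is marked, with $f(k)$ the number of occurrences of $k$ to the left of the marked one (so $1\le f(k)\le(\text{number of occurrences of }k)-1$). The letters $0$ and $\infty$ may occur any number of times. The index is $\mathrm{ind}(\alpha,f)=-1$ if all letters of $\alpha$ are $\infty$ (including the empty sequence when $n=0$), and $\mathrm{ind}(\alpha,f)=\sum_{k=1}^{m(\alpha)}f(k)$ otherwise. $\widetilde{\mathtt{Code}}_n$ is the set of all extended codes of length $n$. *)

theory Defs
  imports
    "HOL-Library.Extended_Nat"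
    "HOL-Library.FuncSet"
    "HOL-Combinatorics.Multiset_Permutations"
    "HOL-Computational_Algebra.Polynomial"
begin

text \<open>Words are lists, which are indexed from 0; positions, and hence the elements of
  \<open>DES w\<close>, are numbered from 1.\<close>

definition DES :: "'a::linorder list \<Rightarrow> nat set" where
  "DES w = {i. 1 \<le> i \<and> i < length w \<and> w ! (i - 1) > w ! i}"

definition maj :: "'a::linorder list \<Rightarrow> nat" where
  "maj w = (\<Sum>i\<in>DES w. i)"

definition inv_num :: "'a::linorder list \<Rightarrow> nat" where
  "inv_num w = card {(i, j). i < j \<and> j < length w \<and> w ! i > w ! j}"

text \<open>A permutation of \<open>{1..k}\<close> is represented by its one-line word, an element of
  \<^term>\<open>permutations_of_set {1..k}\<close>.\<close>

definition exc :: "nat list \<Rightarrow> nat" where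
  "exc w = card {i. 1 \<le> i \<and> i \<le> length w \<and> w ! (i - 1) > i}"

lemma finite_DES [simp]: "finite (DES w)"
  by (rule finite_subset[of _ "{..<length w}"]) (auto simp: DES_def)

text \<open>So the natural-number exponent \<open>maj w - exc w\<close> below is never truncated.\<close>

lemma exc_le_maj:
  assumes "w \<in> permutations_of_set {1..k}"
  shows "exc w \<le> maj w"
proof -
  define d where "d = Max (insert 0 (DES w))"
  have len: "length w = k" and st: "set w = {1..k}"
    using assms length_finite_permutations_of_set[OF assms] 
    by (auto simp: permutations_of_set_def)
  have dis: "distinct w" using assms by (auto simp: permutations_of_set_def)
  have up: "w ! (i - 1) + (k - i) \<le> k" if "d < i" "i \<le> k" for i
    using that(2,1)
  proof (induction i rule: inc_induct)
    case base
    then have "w ! (k - 1) \<in> set w" using len by (intro nth_mem) auto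
    then show ?case using st by auto
  next
    case (step i)
    have "i \<notin> DES w"
    proof
      assume "i \<in> DES w"
      then have "i \<le> d" unfolding d_def by simp
      then show False using step by simp
    qed
    moreover have "w ! (i - 1) \<noteq> w ! i"
      using dis len step by (auto simp: nth_eq_iff_index_eq)
    ultimately have "w ! (i - 1) < w ! i"
      using step len by (auto simp: DES_def not_less)
    then show ?case using step by simp
  qed
  have "{i. 1 \<le> i \<and> i \<le> length w \<and> w ! (i - 1) > i} \<subseteq> {1..d}"
  proof safe
    fix i assume i: "1 \<le> i" "i \<le> length w" "w ! (i - 1) > i"
    show "i \<in> {1..d}"
    proof (rule ccontr)
      assume "i \<notin> {1..d}"
      then have "d < i" using i by auto
      from up[OF this] i len show False by auto
    qed
  qed
  then have "exc w \<le> d"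
    unfolding exc_def using card_mono[of "{1..d}"] by fastforce
  also have "d \<le> maj w"
  proof (cases "d = 0")
    case False
    have "d \<in> insert 0 (DES w)" unfolding d_def by (rule Max_in) auto
    then have "d \<in> DES w" using False by auto
    then show ?thesis unfolding maj_def by (intro member_le_sum) auto
  qed simp
  finally show ?thesis .
qed

text \<open>The ring \<open>\<int>[q][t]\<close> is represented by \<^typ>\<open>int poly poly\<close>, where
  \<open>t\<close> is the outer variable.\<close>

definition qv :: "int poly poly" where
  "qv = [:[:0, 1:]:]"

definition tv :: "int poly poly" where
  "tv = [:0, 1:]"

definition q_int :: "nat \<Rightarrow> int poly poly" where
  "q_int i = (\<Sum>j<i. qv ^ j)"

definition q_fact :: "nat \<Rightarrow> int poly poly" where
  "q_fact m = (\<Prod>i=1..m. q_int i)"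

text \<open>Used for \<open>k \<le> n\<close> only, where the division is exact
  (\<open>q_binom_mult\<close> below).\<close>

definition q_binom :: "nat \<Rightarrow> nat \<Rightarrow> int poly poly" where
  "q_binom n k = q_fact n div (q_fact k * q_fact (n - k))"

lemma q_int_add: "q_int (m + n) = q_int m + qv ^ m * q_int n"
  by (induction n) (simp_all add: q_int_def power_add algebra_simps)

lemma q_fact_Suc: "q_fact (Suc m) = q_int (Suc m) * q_fact m"
  by (simp add: q_fact_def mult.commute)

lemma q_fact_dvd: "q_fact m * q_fact n dvd q_fact (m + n)"
proof (induction "m + n" arbitrary: m n)
  case 0
  then show ?case by (simp add: q_fact_def)
next
  case (Suc s)
  show ?case
  proof (cases "m = 0 \<or> n = 0")
    case True
    then show ?thesis by (auto simp: q_fact_def)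
  next
    case False
    then obtain a b where ab: "m = Suc a" "n = Suc b" by (metis not0_implies_Suc)
    have "q_fact a * q_fact n dvd q_fact s" "q_fact m * q_fact b dvd q_fact s"
      using Suc.hyps(1)[of a n] Suc.hyps(1)[of m b] Suc.hyps(2) ab by simp_all
    then have "q_int m * (q_fact a * q_fact n) dvd q_int m * q_fact s"
      "(qv ^ m * q_int n) * (q_fact m * q_fact b) dvd (qv ^ m * q_int n) * q_fact s"
      by (simp_all only: mult_dvd_mono dvd_refl)
    then have "q_fact m * q_fact n dvd q_int m * q_fact s"
      "q_fact m * q_fact n dvd (qv ^ m * q_int n) * q_fact s"
      by (auto simp: ab q_fact_Suc mult_ac elim: dvd_mult_left intro: dvd_trans[rotated])
    then have "q_fact m * q_fact n dvd (q_int m + qv ^ m * q_int n) * q_fact s"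
      by (simp add: distrib_right)
    then show ?thesis
      using Suc.hyps(2) by (metis q_fact_Suc q_int_add)
  qed
qed

lemma q_int_nonzero: "i > 0 \<Longrightarrow> q_int i \<noteq> 0"
proof
  assume "i > 0" "q_int i = 0"
  moreover have "poly (poly (q_int i) 0) 1 = int i"
    by (simp add: q_int_def qv_def poly_sum poly_power)
  ultimately show False by simp
qed

lemma q_fact_nonzero: "q_fact m \<noteq> 0"
  by (auto simp: q_fact_def q_int_nonzero)

lemma q_binom_mult:
  assumes "k \<le> n"
  shows "q_binom n k * (q_fact k * q_fact (n - k)) = q_fact n"
  using q_fact_dvd[of k "n - k"] assms by (simp add: q_binom_def)

definition eulerian_A :: "nat \<Rightarrow> int poly poly" where
  "eulerian_A k = (\<Sum>w\<in>permutations_of_set {1..k}. qv ^ (maj w - exc w) * tv ^ exc w)"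

definition binomial_eulerian :: "nat \<Rightarrow> int poly poly" where
  "binomial_eulerian n = 1 + tv * (\<Sum>k=1..n. q_binom n k * eulerian_A k)"

definition max_letter :: "enat list \<Rightarrow> nat" where
  "max_letter \<alpha> = Max (insert 0 {k. enat k \<in> set \<alpha>})"

text \<open>That \<open>f k = j\<close> means that the mark sits on occurrence number \<open>j + 1\<close> of \<open>k\<close> in \<open>\<alpha>\<close>.
  The function \<open>f\<close> has domain \<open>{1..max_letter \<alpha>}\<close>; being extensional, it takes the
  dummy value \<^term>\<open>undefined\<close> elsewhere, so that each extended code is counted once.\<close>

definition ext_codes :: "nat \<Rightarrow> (enat list \<times> (nat \<Rightarrow> nat)) set" where
  "ext_codes n = {(\<alpha>, f). length \<alpha> = n
     \<and> (\<forall>k\<in>{1..max_letter \<alpha>}. 2 \<le> count_list \<alpha> (enat k))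
     \<and> f \<in> (\<Pi>\<^sub>E k\<in>{1..max_letter \<alpha>}. {1..count_list \<alpha> (enat k) - 1})}"

definition ind :: "enat list \<Rightarrow> (nat \<Rightarrow> nat) \<Rightarrow> int" where
  "ind \<alpha> f = (if set \<alpha> \<subseteq> {\<infinity>} then - 1 else int (\<Sum>k=1..max_letter \<alpha>. f k))"

lemma finite_letters: "finite {k. enat k \<in> set \<alpha>}"
proof -
  have "{k. enat k \<in> set \<alpha>} = enat -` set \<alpha>" by auto
  then show ?thesis by (simp add: finite_vimageI inj_on_def)
qed

lemma finite_ext_codes: "finite (ext_codes n)"
proof -
  define W where "W = {\<alpha> :: enat list. set \<alpha> \<subseteq> insert \<infinity> (enat ` {..n}) \<and> length \<alpha> = n}"
  have "max_letter \<alpha> \<le> n"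
    if len: "length \<alpha> = n" and c: "\<forall>k\<in>{1..max_letter \<alpha>}. 2 \<le> count_list \<alpha> (enat k)" for \<alpha>
  proof -
    have "enat k \<in> set \<alpha>" if "k \<in> {1..max_letter \<alpha>}" for k
      using c that count_list_0_iff[of \<alpha> "enat k"] by fastforce
    then have "enat ` {1..max_letter \<alpha>} \<subseteq> set \<alpha>" by auto
    then have "card (enat ` {1..max_letter \<alpha>}) \<le> card (set \<alpha>)" by (intro card_mono) auto
    also have "card (enat ` {1..max_letter \<alpha>}) = max_letter \<alpha>"
      by (subst card_image) (auto simp: inj_on_def)
    finally show ?thesis using card_length[of \<alpha>] len by simp
  qed
  moreover have "x \<in> insert \<infinity> (enat ` {..max_letter \<alpha>})" if "x \<in> set \<alpha>" for x \<alpha>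
  proof (cases x)
    case (enat k)
    then have "k \<le> max_letter \<alpha>"
      unfolding max_letter_def using that finite_letters by (intro Max_ge) auto
    then show ?thesis using enat by auto
  qed simp
  ultimately have "ext_codes n \<subseteq>
      (SIGMA \<alpha>:W. \<Pi>\<^sub>E k\<in>{1..max_letter \<alpha>}. {1..count_list \<alpha> (enat k) - 1})"
    unfolding ext_codes_def W_def by fastforce
  moreover have "finite W"
    unfolding W_def by (intro finite_lists_length_eq) auto
  ultimately show ?thesis
    by (elim finite_subset) (intro finite_SigmaI finite_PiE, auto)
qed

end

theory Submission
  imports Defs "HOL-Library.Product_Lexorder" "HOL-Library.Poly_Mapping"
begin

text \<open>Both \<open>maj\<close> and \<open>inv\<close> have the \<open>q\<close>-multinomial coefficient as generating function on the
  words of a given content, and the index only depends on the content and the marking. Since the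
  letters \<open>\<infinity>\<close> contribute \<open>q_binom n k\<close>, everything reduces to
  \<open>A_k(q,t) = \<Sum>(\<alpha>,f). q^(maj \<alpha>) t^(\<Sum>f)\<close>, summed over the codes of length \<open>k\<close> without \<open>\<infinity>\<close>.

  As \<open>maj - exc\<close> is the sum of the set \<open>DEX\<close> of Shareshian and Wachs, inclusion-exclusion over
  the sets \<open>T\<close> with \<open>DEX \<sigma> \<subseteq> T\<close>, respectively \<open>DES \<alpha> \<subseteq> T\<close>, removes \<open>q\<close>: for each \<open>T\<close> the sum
  of \<open>t^(exc \<sigma>)\<close> has to equal the sum of \<open>t^(\<Sum>f)\<close>. The set \<open>T\<close> cuts the positions into blocks;
  let \<open>\<mu>\<close> be the multiset of the block indices of all positions. Recording for every value the
  block of its position in \<open>\<sigma>\<close>, with a bar if it is an excedance, turns the permutations into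
  coloured words of content \<open>\<mu>\<close>, so that their sum \<open>N(\<mu>)\<close> is a coefficient of a product of linear
  forms, as in MacMahon's Master Theorem. If letters equal to their block may be coloured freely,
  splitting off the initial barred, respectively unbarred, ones among them from every block gives
  \<open>\<Sum>\<kappa>\<subseteq>\<mu>. t^|\<kappa>| N(\<mu> - \<kappa>) = \<Sum>\<kappa>\<subseteq>\<mu>. M(\<mu> - \<kappa>)\<close>, where \<open>M\<close> counts weak excedances. A rotation of the
  linear forms shows \<open>M(\<mu>) = t N(\<mu>)\<close> for \<open>\<mu> \<noteq> \<emptyset>\<close>, which turns this into a recurrence for \<open>N\<close>.
  Removing the largest letter gives the same recurrence for the codes.\<close>

section \<open>MacMahon's theorem on inversions and the major index\<close>

text \<open>\<open>permutations_of_multiset_nonempty\<close> splits off the first letter; reversing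
  before and after turns it into the last one, whose removal changes \<open>maj\<close> and
  \<open>inv_num\<close> in a controlled way.\<close>

lemma sum_permutations_of_multiset_snoc:
  assumes "M \<noteq> {#}"
  shows "(\<Sum>w\<in>permutations_of_multiset M. f w)
    = (\<Sum>x\<in>set_mset M. \<Sum>u\<in>permutations_of_multiset (M - {#x#}). f (u @ [x]))"
proof -
  have "(\<Sum>w\<in>permutations_of_multiset M. f w) = (\<Sum>w\<in>permutations_of_multiset M. f (rev w))"
    by (rule sum.reindex_bij_witness[where i = rev and j = rev]) (auto simp: permutations_of_multiset_def)
  also have "\<dots> = (\<Sum>x\<in>set_mset M. \<Sum>w\<in>(#) x ` permutations_of_multiset (M - {#x#}). f (rev w))"
    using assms by (subst permutations_of_multiset_nonempty) (auto intro!: sum.UNION_disjoint)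
  also have "\<dots> = (\<Sum>x\<in>set_mset M. \<Sum>w\<in>permutations_of_multiset (M - {#x#}). f (rev w @ [x]))"
    by (rule sum.cong[OF refl], subst sum.reindex) (auto simp: inj_on_def)
  also have "\<dots> = (\<Sum>x\<in>set_mset M. \<Sum>u\<in>permutations_of_multiset (M - {#x#}). f (u @ [x]))"
    by (rule sum.cong[OF refl], rule sum.reindex_bij_witness[where i = rev and j = rev])
      (auto simp: permutations_of_multiset_def)
  finally show ?thesis .
qed

lemma DES_snoc:
  "DES (u @ [x]) = DES u \<union> (if u \<noteq> [] \<and> last u > x then {length u} else {})"
proof (cases u rule: rev_cases)
  case (snoc us y)
  then show ?thesis
    by (auto simp: DES_def nth_append less_Suc_eq not_less)
qed (auto simp: DES_def)

lemma maj_snoc: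
  "maj (u @ [x]) = maj u + (if u \<noteq> [] \<and> last u > x then length u else 0)"
proof -
  have "length u \<notin> DES u" by (auto simp: DES_def)
  then show ?thesis by (simp add: maj_def DES_snoc)
qed

lemma maj_Nil [simp]: "maj [] = 0" and maj_singleton [simp]: "maj [x] = 0"
  using maj_snoc[of "[]" x] by (simp_all add: maj_def DES_def)

lemma inv_num_snoc:
  "inv_num (u @ [x]) = inv_num u + size (filter_mset (\<lambda>z. z > x) (mset u))"
proof -
  let ?A = "{(i, j). i < j \<and> j < length u \<and> u ! i > u ! j}"
  let ?B = "(\<lambda>i. (i, length u)) ` {i. i < length u \<and> u ! i > x}"
  have "{(i, j). i < j \<and> j < length (u @ [x]) \<and> (u @ [x]) ! i > (u @ [x]) ! j} = ?A \<union> ?B"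
    by (auto simp: nth_append less_Suc_eq)
  moreover have "finite ?A"
    by (rule finite_subset[of _ "{..<length u} \<times> {..<length u}"]) auto
  ultimately have "inv_num (u @ [x]) = card ?A + card ?B"
    unfolding inv_num_def by (simp add: card_Un_disjoint disjoint_iff image_iff)
  moreover have "card ?B = size (filter_mset (\<lambda>z. z > x) (mset u))"
    by (subst card_image) (auto simp: inj_on_def length_filter_conv_card simp flip: mset_filter)
  ultimately show ?thesis by (simp add: inv_num_def)
qed

section \<open>The denominator of the q-multinomial coefficient\<close>

definition q_mset_fact :: "'a multiset \<Rightarrow> int poly poly" where
  "q_mset_fact M = (\<Prod>x\<in>set_mset M. q_fact (count M x))"

lemma q_mset_fact_nonzero: "q_mset_fact M \<noteq> 0"
  by (simp add: q_mset_fact_def q_fact_nonzero)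

lemma q_mset_fact_superset:
  "finite S \<Longrightarrow> set_mset M \<subseteq> S \<Longrightarrow> q_mset_fact M = (\<Prod>x\<in>S. q_fact (count M x))"
  unfolding q_mset_fact_def
  by (rule prod.mono_neutral_left) (auto simp: not_in_iff q_fact_def)

lemma q_mset_fact_remove:
  assumes "x \<in># M"
  shows "q_mset_fact M = q_int (count M x) * q_mset_fact (M - {#x#})"
proof -
  have "q_mset_fact M = q_fact (count M x) * (\<Prod>y\<in>set_mset M - {x}. q_fact (count M y))"
    unfolding q_mset_fact_def using assms by (simp add: prod.remove)
  also have "q_fact (count M x) = q_int (count M x) * q_fact (count M x - 1)"
    using assms q_fact_Suc[of "count M x - 1"] by (simp del: count_greater_zero_iff add: count_greater_zero_iff[symmetric])
  also have "(\<Prod>y\<in>set_mset M - {x}. q_fact (count M y)) = (\<Prod>y\<in>set_mset M - {x}. q_fact (count (M - {#x#}) y))"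
    by (intro prod.cong) auto
  also have "q_int (count M x) * q_fact (count M x - 1) * (\<Prod>y\<in>set_mset M - {x}. q_fact (count (M - {#x#}) y))
     = q_int (count M x) * (\<Prod>y\<in>set_mset M. q_fact (count (M - {#x#}) y))"
    using assms by (simp add: prod.remove mult.assoc)
  also have "(\<Prod>y\<in>set_mset M. q_fact (count (M - {#x#}) y)) = q_mset_fact (M - {#x#})"
    by (rule q_mset_fact_superset[symmetric]) (auto dest: in_diffD)
  finally show ?thesis .
qed

text \<open>The exponents 0, 1, 2, ... of the right-hand side are cut into consecutive runs, one of
  length \<open>c y\<close> for each letter, larger letters first. The induction adds a new smallest
  letter, whose run comes last.\<close>

lemma sum_q_int_gt:
  fixes c :: "'a::linorder \<Rightarrow> nat"
  assumes "finite S"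
  shows "(\<Sum>y\<in>S. qv ^ (\<Sum>z\<in>{z\<in>S. z > y}. c z) * q_int (c y)) = q_int (\<Sum>z\<in>S. c z)"
  using assms
proof (induction rule: finite_linorder_min_induct)
  case empty
  then show ?case by (simp add: q_int_def)
next
  case (insert b A)
  have 1: "{z\<in>insert b A. z > b} = A" using insert.hyps by auto
  have 2: "{z\<in>insert b A. z > y} = {z\<in>A. z > y}" if "y \<in> A" for y
    using insert.hyps that by (auto dest: less_asym)
  have "b \<notin> A" using insert.hyps by auto
  then have "(\<Sum>y\<in>insert b A. qv ^ (\<Sum>z\<in>{z\<in>insert b A. z > y}. c z) * q_int (c y))
     = qv ^ (\<Sum>z\<in>A. c z) * q_int (c b) + (\<Sum>y\<in>A. qv ^ (\<Sum>z\<in>{z\<in>A. z > y}. c z) * q_int (c y))"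
    by (simp only: sum.insert[OF insert.hyps(1) \<open>b \<notin> A\<close>] 1 2 cong: sum.cong)
  also have "\<dots> = q_int ((\<Sum>z\<in>A. c z) + c b)"
    by (simp add: insert.IH q_int_add)
  finally show ?case using \<open>b \<notin> A\<close> insert.hyps by (simp add: add.commute)
qed

definition num_gt :: "'a::linorder multiset \<Rightarrow> 'a \<Rightarrow> nat" where
  "num_gt M x = size (filter_mset (\<lambda>z. z > x) M)"

lemma num_gt_conv_sum: "num_gt M y = (\<Sum>z\<in>{z\<in>set_mset M. z > y}. count M z)"
  unfolding num_gt_def size_multiset_overloaded_eq
  by (intro sum.cong) auto

lemma sum_num_gt:
  "(\<Sum>y\<in>set_mset M. qv ^ num_gt M y * q_int (count M y)) = q_int (size M)"
  unfolding num_gt_conv_sum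
  by (subst sum_q_int_gt) (simp_all add: size_multiset_overloaded_eq)

text \<open>The previous identity for the order in which the letters greater than \<open>x\<close> are moved
  below the other ones.\<close>

lemma sum_num_gt_rotated:
  "(\<Sum>y\<in>set_mset M. qv ^ (num_gt M y + (if y > x then size M else 0)) * q_int (count M y))
     = qv ^ num_gt M x * q_int (size M)"
proof -
  let ?G = "filter_mset (\<lambda>z. z > x) M" and ?L = "filter_mset (\<lambda>z. \<not> z > x) M"
  have M: "M = ?L + ?G" by (simp add: add.commute multiset_partition)
  then have sz: "size M = size ?L + num_gt M x"
    unfolding num_gt_def by (metis size_union)
  have G: "num_gt M y = num_gt ?G y" if "y > x" for y
    unfolding num_gt_def filter_filter_mset using that
    by (intro arg_cong[where f = size] filter_mset_cong) auto
  have L: "num_gt M y = num_gt M x + num_gt ?L y" if "\<not> y > x" for y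
  proof -
    have "filter_mset (\<lambda>z. z > y) M = ?G + filter_mset (\<lambda>z. z > y) ?L"
      using that by (auto simp: multiset_eq_iff)
    then show ?thesis by (simp add: num_gt_def)
  qed
  have split: "set_mset M = set_mset ?L \<union> set_mset ?G" "set_mset ?L \<inter> set_mset ?G = {}" by auto
  have "(\<Sum>y\<in>set_mset M. qv ^ (num_gt M y + (if y > x then size M else 0)) * q_int (count M y))
      = (\<Sum>y\<in>set_mset ?L. qv ^ (num_gt M y + (if y > x then size M else 0)) * q_int (count M y))
      + (\<Sum>y\<in>set_mset ?G. qv ^ (num_gt M y + (if y > x then size M else 0)) * q_int (count M y))"
    by (subst split(1), rule sum.union_disjoint) auto
  also have "(\<Sum>y\<in>set_mset ?L. qv ^ (num_gt M y + (if y > x then size M else 0)) * q_int (count M y))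
      = qv ^ num_gt M x * q_int (size ?L)"
    unfolding sum_num_gt[of ?L, symmetric] sum_distrib_left
    by (intro sum.cong) (auto simp flip: L power_add mult.assoc)
  also have "(\<Sum>y\<in>set_mset ?G. qv ^ (num_gt M y + (if y > x then size M else 0)) * q_int (count M y))
      = qv ^ size M * q_int (num_gt M x)"
    unfolding num_gt_def[of M x] sum_num_gt[of ?G, symmetric] sum_distrib_left
    by (intro sum.cong) (auto simp: G power_add mult_ac)
  also have "qv ^ num_gt M x * q_int (size ?L) + qv ^ size M * q_int (num_gt M x)
      = qv ^ num_gt M x * q_int (size M)"
    unfolding sz q_int_add by (simp add: power_add algebra_simps)
  finally show ?thesis .
qed

text \<open>A last letter \<open>x\<close> adds \<open>num_gt M x\<close> inversions, and removing
  it takes the factor \<open>q_int (count M x)\<close> out of the denominator;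
  \<open>sum_num_gt\<close> sums these products to \<open>q_int (size M)\<close>. Multiplying by
  \<open>q_mset_fact M\<close> avoids a division.\<close>

lemma sum_inv_num:
  "q_mset_fact M * (\<Sum>w\<in>permutations_of_multiset M. qv ^ inv_num w) = q_fact (size M)"
proof (induction "size M" arbitrary: M)
  case 0
  then show ?case by (simp add: q_mset_fact_def q_fact_def inv_num_def)
next
  case (Suc s)
  then have "M \<noteq> {#}" by auto
  have "q_mset_fact M * (\<Sum>u\<in>permutations_of_multiset (M - {#x#}). qv ^ inv_num (u @ [x]))
      = q_fact s * (qv ^ num_gt M x * q_int (count M x))" if x: "x \<in># M" for x
  proof -
    have s: "s = size (M - {#x#})" using x Suc.hyps by (simp add: size_Diff_singleton)
    have num: "num_gt (M - {#x#}) x = num_gt M x"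
      unfolding num_gt_def by simp
    have "q_mset_fact M * (\<Sum>u\<in>permutations_of_multiset (M - {#x#}). qv ^ inv_num (u @ [x]))
      = q_int (count M x) * (q_mset_fact (M - {#x#}) *
          (\<Sum>u\<in>permutations_of_multiset (M - {#x#}). qv ^ inv_num u * qv ^ num_gt M x))"
      using x by (simp add: q_mset_fact_remove inv_num_snoc permutations_of_multisetD
          num_gt_def[symmetric] num power_add mult.assoc)
    also have "\<dots> = q_int (count M x) * (q_fact s * qv ^ num_gt M x)"
      unfolding sum_distrib_right[symmetric] using Suc.hyps(1)[OF s] s by (simp add: mult.assoc[symmetric])
    finally show ?thesis by (simp add: mult_ac)
  qed
  then have "q_mset_fact M * (\<Sum>w\<in>permutations_of_multiset M. qv ^ inv_num w) = q_fact s * q_int (size M)"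
    using \<open>M \<noteq> {#}\<close>
    by (simp add: sum_permutations_of_multiset_snoc sum_distrib_left[of "q_mset_fact M"]
        sum_distrib_left[of "q_fact s"] flip: sum_num_gt)
  then show ?case using Suc.hyps(2)[symmetric] by (simp add: q_fact_Suc mult.commute)
qed

text \<open>Whether the appended \<open>x\<close> creates a descent depends on the letter before it,
  so the induction needs the last letter fixed. With \<open>N = M - {#x#}\<close>, a preceding
  \<open>y > x\<close> costs \<open>size N\<close> more, and the sum over \<open>y\<close> is
  \<open>sum_num_gt_rotated\<close> for \<open>N\<close>.\<close>

lemma sum_maj_snoc:
  assumes "x \<in># M"
  shows "q_mset_fact M * (\<Sum>u\<in>permutations_of_multiset (M - {#x#}). qv ^ maj (u @ [x]))
    = qv ^ num_gt M x * q_int (count M x) * q_fact (size M - 1)"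
  using assms
proof (induction "size M" arbitrary: M x)
  case 0
  then show ?case by simp
next
  case (Suc s)
  define N where "N = M - {#x#}"
  have sN: "size N = s" using Suc by (simp add: N_def size_Diff_singleton)
  have num: "num_gt N x = num_gt M x"
    unfolding num_gt_def N_def by simp
  have M: "q_mset_fact M = q_int (count M x) * q_mset_fact N"
    unfolding N_def by (rule q_mset_fact_remove) fact
  have "q_mset_fact N * (\<Sum>u\<in>permutations_of_multiset N. qv ^ maj (u @ [x])) = qv ^ num_gt N x * q_fact s"
  proof (cases "N = {#}")
    case True
    then show ?thesis using sN by (simp add: q_mset_fact_def q_fact_def num_gt_def)
  next
    case False
    then obtain s' where s': "s = Suc s'" using sN by (cases s) auto
    have "q_mset_fact N * (\<Sum>u\<in>permutations_of_multiset (N - {#y#}). qv ^ maj (u @ [y] @ [x]))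
       = q_fact s' * (qv ^ (num_gt N y + (if y > x then size N else 0)) * q_int (count N y))"
      if y: "y \<in># N" for y
    proof -
      have "maj (u @ [y] @ [x]) = maj (u @ [y]) + (if y > x then size N else 0)"
        if "u \<in> permutations_of_multiset (N - {#y#})" for u
      proof -
        have "length (u @ [y]) = size N"
          using that y by (metis length_finite_permutations_of_multiset length_append_singleton
              size_Suc_Diff1)
        then show ?thesis using maj_snoc[of "u @ [y]" x] by simp
      qed
      then have "q_mset_fact N * (\<Sum>u\<in>permutations_of_multiset (N - {#y#}). qv ^ maj (u @ [y] @ [x]))
        = q_mset_fact N * (\<Sum>u\<in>permutations_of_multiset (N - {#y#}). qv ^ maj (u @ [y]))
            * qv ^ (if y > x then size N else 0)"
        by (simp only: power_add sum_distrib_right mult.assoc cong: sum.cong)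
      also have "\<dots> = qv ^ num_gt N y * q_int (count N y) * q_fact s' * qv ^ (if y > x then size N else 0)"
        using Suc.hyps(1)[OF sN[symmetric] y] sN s' by simp
      finally show ?thesis by (simp only: power_add mult_ac)
    qed
    then have "q_mset_fact N * (\<Sum>u\<in>permutations_of_multiset N. qv ^ maj (u @ [x]))
       = q_fact s' * (\<Sum>y\<in>set_mset N. qv ^ (num_gt N y + (if y > x then size N else 0)) * q_int (count N y))"
      using False by (simp add: sum_permutations_of_multiset_snoc sum_distrib_left cong: sum.cong)
    then show ?thesis unfolding sum_num_gt_rotated
      using sN s' by (simp add: q_fact_Suc mult_ac)
  qed
  then show ?case using M sN Suc.hyps(2) num by (simp add: N_def[symmetric] mult_ac flip: Suc.hyps(2))
qed

lemma sum_maj: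
  "q_mset_fact M * (\<Sum>w\<in>permutations_of_multiset M. qv ^ maj w) = q_fact (size M)"
proof (cases "M = {#}")
  case True
  then show ?thesis by (simp add: q_mset_fact_def q_fact_def)
next
  case False
  then obtain s where s: "size M = Suc s" by (cases "size M") auto
  have "q_mset_fact M * (\<Sum>w\<in>permutations_of_multiset M. qv ^ maj w)
     = (\<Sum>x\<in>set_mset M. q_mset_fact M * (\<Sum>u\<in>permutations_of_multiset (M - {#x#}). qv ^ maj (u @ [x])))"
    unfolding sum_permutations_of_multiset_snoc[OF False] by (simp only: sum_distrib_left)
  also have "\<dots> = (\<Sum>x\<in>set_mset M. qv ^ num_gt M x * q_int (count M x)) * q_fact s"
    using s by (simp add: sum_maj_snoc sum_distrib_right)
  finally show ?thesis unfolding sum_num_gt using s by (simp add: q_fact_Suc)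
qed

lemma sum_inv_num_eq_sum_maj:
  "(\<Sum>w\<in>permutations_of_multiset M. qv ^ inv_num w) = (\<Sum>w\<in>permutations_of_multiset M. qv ^ maj w)"
  using sum_inv_num[of M] sum_maj[of M] q_mset_fact_nonzero[of M]
  by (metis mult_left_cancel)

section \<open>Excedances and coloured words\<close>

text \<open>The factors in front of the inner sums depend on \<open>T\<close> alone, so two families
  agree as soon as these inner sums agree for every \<open>T\<close>.\<close>

lemma sum_power_sum_eq:
  fixes c :: "'b \<Rightarrow> 'a::comm_ring_1" and D :: "'b \<Rightarrow> nat set"
  assumes "finite X" "finite I" "\<And>x. x \<in> X \<Longrightarrow> D x \<subseteq> I"
  shows "(\<Sum>x\<in>X. c x * q ^ (\<Sum>i\<in>D x. i))
    = (\<Sum>T\<in>Pow I. (\<Prod>i\<in>T. q ^ i) * (\<Prod>i\<in>I - T. 1 - q ^ i) * (\<Sum>x\<in>{x\<in>X. D x \<subseteq> T}. c x))"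
proof -
  have *: "q ^ (\<Sum>i\<in>D x. i)
      = (\<Sum>T\<in>Pow I. if D x \<subseteq> T then (\<Prod>i\<in>T. q ^ i) * (\<Prod>i\<in>I - T. 1 - q ^ i) else 0)"
    if "x \<in> X" for x
  proof -
    \<comment> \<open>Outside \<open>D x\<close> the summands \<open>q ^ i\<close> and
      \<open>g i\<close> add up to 1, inside it \<open>g i\<close> is 0. Expanding the product over
      \<open>I\<close> kills every \<open>T\<close> that does not contain
      \<open>D x\<close>.\<close>
    define g where "g = (\<lambda>i. if i \<in> D x then 0 else 1 - q ^ i)"
    have "q ^ (\<Sum>i\<in>D x. i) = (\<Prod>i\<in>D x. q ^ i)" by (simp add: power_sum)
    also have "\<dots> = (\<Prod>i\<in>I. q ^ i + g i)"
      by (rule prod.mono_neutral_cong_left) (use assms that in \<open>auto simp: g_def\<close>)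
    also have "\<dots> = (\<Sum>T\<in>Pow I. (\<Prod>i\<in>T. q ^ i) * (\<Prod>i\<in>I - T. g i))"
      using assms(2) by (rule prod_add)
    also have "\<dots> = (\<Sum>T\<in>Pow I. if D x \<subseteq> T then (\<Prod>i\<in>T. q ^ i) * (\<Prod>i\<in>I - T. 1 - q ^ i) else 0)"
    proof (rule sum.cong[OF refl])
      fix T assume "T \<in> Pow I"
      show "(\<Prod>i\<in>T. q ^ i) * (\<Prod>i\<in>I - T. g i)
        = (if D x \<subseteq> T then (\<Prod>i\<in>T. q ^ i) * (\<Prod>i\<in>I - T. 1 - q ^ i) else 0)"
      proof (cases "D x \<subseteq> T")
        case True
        then have "(\<Prod>i\<in>I - T. g i) = (\<Prod>i\<in>I - T. 1 - q ^ i)"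
          by (intro prod.cong) (auto simp: g_def)
        then show ?thesis using True by simp
      next
        case False
        then obtain i where "i \<in> D x" "i \<notin> T" by auto
        then have "(\<Prod>i\<in>I - T. g i) = 0"
          using assms that by (intro prod_zero) (auto simp: g_def)
        then show ?thesis using False by simp
      qed
    qed
    finally show ?thesis .
  qed
  have "(\<Sum>x\<in>X. c x * q ^ (\<Sum>i\<in>D x. i))
      = (\<Sum>x\<in>X. \<Sum>T\<in>Pow I. if D x \<subseteq> T then (\<Prod>i\<in>T. q ^ i) * (\<Prod>i\<in>I - T. 1 - q ^ i) * c x else 0)"
    by (intro sum.cong) (auto simp: * sum_distrib_left mult_ac intro!: sum.cong)
  also have "\<dots> = (\<Sum>T\<in>Pow I. \<Sum>x\<in>X. if D x \<subseteq> T then (\<Prod>i\<in>T. q ^ i) * (\<Prod>i\<in>I - T. 1 - q ^ i) * c x else 0)"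
    by (rule sum.swap)
  also have "\<dots> = (\<Sum>T\<in>Pow I. (\<Prod>i\<in>T. q ^ i) * (\<Prod>i\<in>I - T. 1 - q ^ i) * (\<Sum>x\<in>{x\<in>X. D x \<subseteq> T}. c x))"
    using assms(1) by (intro sum.cong) (auto simp: sum_distrib_left sum.inter_filter intro!: sum.cong)
  finally show ?thesis .
qed

text \<open>\<open>DEX w\<close> is the descent set of \<open>w\<close> after the letters at the excedances have been barred,
  the barred letters being smaller than the other ones. The key \<open>(False, _)\<close> stands for a
  barred letter.\<close>

definition dex_key :: "nat list \<Rightarrow> nat \<Rightarrow> bool \<times> nat" where
  "dex_key w i = (w ! i \<le> Suc i, w ! i)"

definition DEX :: "nat list \<Rightarrow> nat set" where
  "DEX w = {i. 1 \<le> i \<and> i < length w \<and> dex_key w (i - 1) > dex_key w i}"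

lemma exc_eq_sum: "exc w = (\<Sum>i<length w. of_bool (w ! i > Suc i))"
proof -
  have "{i. 1 \<le> i \<and> i \<le> length w \<and> w ! (i - 1) > i} = Suc ` {i. i < length w \<and> w ! i > Suc i}"
    by (auto simp: image_iff Suc_le_eq gr0_conv_Suc)
  then show ?thesis unfolding exc_def
    by (simp add: card_image sum.inter_filter[symmetric] of_bool_def Int_def conj_commute)
qed

text \<open>Between positions of the same kind (excedance or not), \<open>DES\<close> and \<open>DEX\<close> agree. The
  positions where an excedance is followed by a non-excedance lie in \<open>DES\<close> only, those where a
  non-excedance is followed by an excedance in \<open>DEX\<close> only; the sum of the former minus the sum
  of the latter telescopes to the number of excedances.\<close>

lemma sum_DEX:
  assumes "w \<in> permutations_of_set {1..k}"
  shows "(\<Sum>i\<in>DEX w. i) = maj w - exc w"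
proof (cases "k = 0")
  case True
  then show ?thesis using assms by (simp add: DEX_def exc_def maj_def DES_def)
next
  case False
  have len: "length w = k" and st: "set w = {1..k}"
    using assms length_finite_permutations_of_set[OF assms] by (auto simp: permutations_of_set_def)
  define e :: "nat \<Rightarrow> int" where "e i = of_bool (w ! i > Suc i)" for i
  \<comment> \<open>No value exceeds \<open>k\<close>, so the last position is no excedance and the
    boundary term in the summation by parts \<open>tel\<close> vanishes.\<close>
  have last: "e (k - 1) = 0"
  proof -
    have "w ! (k - 1) \<in> set w" using len False by (intro nth_mem) auto
    then show ?thesis using st False by (auto simp: e_def)
  qed
  have step: "int i * of_bool (i \<in> DEX w) = int i * of_bool (i \<in> DES w) - int i * (e (i - 1) - e i)"
    if "i \<in> {1..<k}" for i
  proof -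
    have "distinct w" using assms by (simp add: permutations_of_set_def)
    then have "w ! i \<noteq> w ! (i - 1)"
      using that len by (subst nth_eq_iff_index_eq) auto
    then show ?thesis
      using that len by (auto simp: DEX_def DES_def dex_key_def e_def less_prod_def of_bool_def)
  qed
  have tel: "(\<Sum>i\<in>{1..<Suc m}. int i * (e (i - 1) - e i)) = (\<Sum>i<Suc m. e i) - int (Suc m) * e m" for m
    by (induction m) (simp_all add: algebra_simps)
  have sum_set: "int (\<Sum>i\<in>S. i) = (\<Sum>i\<in>{1..<k}. int i * of_bool (i \<in> S))" if "S \<subseteq> {1..<k}" for S
    unfolding of_nat_sum using that by (intro sum.mono_neutral_cong_left) auto
  have "int (\<Sum>i\<in>DEX w. i) = (\<Sum>i\<in>{1..<k}. int i * of_bool (i \<in> DEX w))"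
    by (rule sum_set) (use len in \<open>auto simp: DEX_def\<close>)
  also have "\<dots> = (\<Sum>i\<in>{1..<k}. int i * of_bool (i \<in> DES w)) - (\<Sum>i\<in>{1..<k}. int i * (e (i - 1) - e i))"
    unfolding sum_subtractf[symmetric] by (intro sum.cong refl step)
  also have "(\<Sum>i\<in>{1..<k}. int i * of_bool (i \<in> DES w)) = int (maj w)"
    unfolding maj_def by (rule sum_set[symmetric]) (use len in \<open>auto simp: DES_def\<close>)
  also have "(\<Sum>i\<in>{1..<k}. int i * (e (i - 1) - e i)) = int (exc w)"
    using tel[of "k - 1"] False last by (simp add: exc_eq_sum len e_def)
  finally show ?thesis using exc_le_maj[OF assms] by linarith
qed

section \<open>The bijection between permutations and coloured words\<close>

definition blockwise_dex_perms :: "nat list \<Rightarrow> nat list set" where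
  "blockwise_dex_perms \<beta> = {w \<in> permutations_of_set {1..length \<beta>}.
     \<forall>i. Suc i < length \<beta> \<longrightarrow> \<beta> ! i = \<beta> ! Suc i \<longrightarrow> dex_key w i \<le> dex_key w (Suc i)}"

text \<open>The index \<open>u\<close> stands for the value \<open>Suc u\<close>, not for a
  position. At position \<open>i\<close>, counted from 0, this value is an excedance iff
  \<open>i < u\<close>. So a barred block (\<open>False\<close>) has to meet the first
  \<open>u\<close> positions, an unbarred one the others.\<close>

definition colour_choices :: "nat list \<Rightarrow> nat \<Rightarrow> (nat \<times> bool) set" where
  "colour_choices \<beta> u = set (take u \<beta>) \<times> {False} \<union> set (drop u \<beta>) \<times> {True}"

definition coloured_words :: "nat list \<Rightarrow> (nat \<Rightarrow> nat \<times> bool) set" where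
  "coloured_words \<beta> = {c \<in> Pi\<^sub>E {..<length \<beta>} (colour_choices \<beta>).
     image_mset (\<lambda>u. fst (c u)) (mset_set {..<length \<beta>}) = mset \<beta>}"

definition perm_to_coloured :: "nat list \<Rightarrow> nat list \<Rightarrow> nat \<Rightarrow> nat \<times> bool" where
  "perm_to_coloured \<beta> w = (\<lambda>u\<in>{..<length \<beta>}.
     let i = the_inv_into {..<length \<beta>} (\<lambda>i. w ! i) (Suc u) in (\<beta> ! i, u \<le> i))"

text \<open>Sorting the values by block, then colour, then size fills the positions from left to
  right: inside a block, barred values come first because \<open>False < True\<close>, and each
  colour class increases.\<close>

definition coloured_to_perm :: "nat list \<Rightarrow> (nat \<Rightarrow> nat \<times> bool) \<Rightarrow> nat list" where
  "coloured_to_perm \<beta> c = map Suc (sort_key (\<lambda>u. (c u, u)) [0..<length \<beta>])"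

lemma perm_to_coloured_nth:
  assumes "w \<in> permutations_of_set {1..length \<beta>}" "i < length \<beta>"
  shows "perm_to_coloured \<beta> w (w ! i - 1) = (\<beta> ! i, w ! i \<le> Suc i)" "w ! i \<in> {1..length \<beta>}"
proof -
  have len: "length w = length \<beta>" and st: "set w = {1..length \<beta>}" and dis: "distinct w"
    using assms length_finite_permutations_of_set[OF assms(1)] by (auto simp: permutations_of_set_def)
  show w: "w ! i \<in> {1..length \<beta>}" using nth_mem[of i w] assms len st by auto
  have "the_inv_into {..<length \<beta>} (\<lambda>i. w ! i) (w ! i) = i"
    using dis len assms(2) by (intro the_inv_into_f_f) (auto simp: inj_on_def nth_eq_iff_index_eq)
  then show "perm_to_coloured \<beta> w (w ! i - 1) = (\<beta> ! i, w ! i \<le> Suc i)"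
    using w by (auto simp: perm_to_coloured_def Let_def)
qed

lemma image_mset_perm:
  assumes "w \<in> permutations_of_set {1..n}"
  shows "mset_set {..<n} = image_mset (\<lambda>i. w ! i - 1) (mset_set {..<n})"
proof -
  have len: "length w = n" and st: "set w = {1..n}" and dis: "distinct w"
    using assms length_finite_permutations_of_set[OF assms(1)] by (auto simp: permutations_of_set_def)
  have "bij_betw (\<lambda>i. w ! i) {..<n} {1..n}"
    using bij_betw_nth[OF dis, of "{..<n}" "{1..n}"] len st by simp
  moreover have "bij_betw (\<lambda>v. v - 1) {1..n} {..<n}"
    by (rule bij_betwI[where g = Suc]) auto
  ultimately have "bij_betw ((\<lambda>v. v - 1) \<circ> (\<lambda>i. w ! i)) {..<n} {..<n}"
    by (rule bij_betw_trans)
  then show ?thesis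
    by (simp add: bij_betw_def image_mset_mset_set comp_def)
qed

lemma perm_to_coloured_mem:
  assumes "w \<in> permutations_of_set {1..length \<beta>}"
  shows "perm_to_coloured \<beta> w \<in> coloured_words \<beta>"
proof -
  let ?n = "length \<beta>"
  note nth = perm_to_coloured_nth[OF assms]
  have "perm_to_coloured \<beta> w u \<in> colour_choices \<beta> u" if u: "u < ?n" for u
  proof -
    have "Suc u \<in> set w" using u assms by (auto simp: permutations_of_set_def)
    then obtain i where i: "i < ?n" "w ! i = Suc u"
      using length_finite_permutations_of_set[OF assms] by (auto simp: in_set_conv_nth)
    have "\<beta> ! i \<in> set (take u \<beta>)" if "i < u"
      using that i u by (auto simp: in_set_conv_nth intro!: exI[of _ i])
    moreover have "\<beta> ! i \<in> set (drop u \<beta>)" if "u \<le> i"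
      using that i u by (auto simp: in_set_conv_nth intro!: exI[of _ "i - u"])
    ultimately show ?thesis
      using nth(1)[OF i(1)] i(2) by (cases "u \<le> i") (auto simp: colour_choices_def)
  qed
  moreover have "image_mset (\<lambda>u. fst (perm_to_coloured \<beta> w u)) (mset_set {..<?n}) = mset \<beta>"
  proof -
    have "image_mset (\<lambda>u. fst (perm_to_coloured \<beta> w u)) (mset_set {..<?n})
       = image_mset (\<lambda>i. fst (perm_to_coloured \<beta> w (w ! i - 1))) (mset_set {..<?n})"
      by (subst image_mset_perm[OF assms]) (simp add: image_mset.compositionality comp_def)
    also have "\<dots> = image_mset (\<lambda>i. \<beta> ! i) (mset_set {..<?n})"
      by (intro image_mset_cong) (simp add: nth(1)[unfolded One_nat_def])
    also have "\<dots> = mset (map (\<lambda>i. \<beta> ! i) [0..<?n])"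
      by (simp add: mset_map lessThan_atLeast0)
    finally show ?thesis by (simp add: map_nth)
  qed
  ultimately show ?thesis
    by (auto simp: coloured_words_def perm_to_coloured_def)
qed

text \<open>The key is injective, so the values have only one sorted arrangement and it suffices
  that \<open>w\<close> is sorted: \<beta> takes care of neighbours in different blocks, the
  condition on \<open>dex_key\<close> of those in the same block.\<close>

lemma coloured_to_perm_to_coloured:
  assumes "sorted \<beta>" and w: "w \<in> blockwise_dex_perms \<beta>"
  shows "coloured_to_perm \<beta> (perm_to_coloured \<beta> w) = w"
proof -
  let ?n = "length \<beta>"
  have perm: "w \<in> permutations_of_set {1..?n}"
    and dex: "\<And>i. Suc i < ?n \<Longrightarrow> \<beta> ! i = \<beta> ! Suc i \<Longrightarrow> dex_key w i \<le> dex_key w (Suc i)"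
    using w by (auto simp: blockwise_dex_perms_def)
  have len: "length w = ?n" and st: "set w = {1..?n}" and dis: "distinct w"
    using perm length_finite_permutations_of_set[OF perm] by (auto simp: permutations_of_set_def)
  note nth = perm_to_coloured_nth[OF perm]
  define p where "p = map (\<lambda>v. v - 1) w"
  have "sort_key (\<lambda>u. (perm_to_coloured \<beta> w u, u)) [0..<?n] = p"
  proof (rule sort_key_inj_key_eq)
    have "mset p = mset_set {..<?n}"
    proof -
      have "p = map (\<lambda>i. w ! i - 1) [0..<?n]" by (rule nth_equalityI) (simp_all add: p_def len)
      then show ?thesis using image_mset_perm[OF perm] by (simp add: lessThan_atLeast0)
    qed
    then show "mset [0..<?n] = mset p" by (simp add: lessThan_atLeast0)
    show "inj_on (\<lambda>u. (perm_to_coloured \<beta> w u, u)) (set [0..<?n])" by (auto simp: inj_on_def)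
    show "sorted (map (\<lambda>u. (perm_to_coloured \<beta> w u, u)) p)"
      unfolding sorted_iff_nth_Suc
    proof safe
      fix i assume "Suc i < length (map (\<lambda>u. (perm_to_coloured \<beta> w u, u)) p)"
      then have i: "Suc i < ?n" by (simp add: p_def len)
      have "\<beta> ! i \<le> \<beta> ! Suc i" using assms(1) i by (simp add: sorted_iff_nth_Suc)
      then show "map (\<lambda>u. (perm_to_coloured \<beta> w u, u)) p ! i \<le> map (\<lambda>u. (perm_to_coloured \<beta> w u, u)) p ! Suc i"
        using i dex[OF i] nth[of i] nth[of "Suc i"]
        by (cases "\<beta> ! i = \<beta> ! Suc i")
          (auto simp: p_def len less_eq_prod_def less_prod_def dex_key_def)
    qed
  qed
  moreover have "map Suc p = w"
    unfolding p_def map_map by (rule map_idI) (use st in auto)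
  ultimately show ?thesis by (simp add: coloured_to_perm_def)
qed

text \<open>Within a block, the barred letters come first and the values increase along each colour.
  So an excess at the first barred position, or a non-excess at the last unbarred one, spreads
  to all positions of that colour.\<close>

lemma coloured_to_perm_props:
  assumes "sorted \<beta>" and c: "c \<in> coloured_words \<beta>"
  shows "coloured_to_perm \<beta> c \<in> blockwise_dex_perms \<beta>"
    and "i < length \<beta> \<Longrightarrow>
      c (coloured_to_perm \<beta> c ! i - 1) = (\<beta> ! i, coloured_to_perm \<beta> c ! i \<le> Suc i)"
proof -
  let ?n = "length \<beta>"
  define p where "p = sort_key (\<lambda>u. (c u, u)) [0..<?n]"
  have len: "length p = ?n" and dis: "distinct p" and st: "set p = {..<?n}"
    by (auto simp: p_def)
  have sorted_p: "sorted (map (\<lambda>u. (c u, u)) p)" by (simp add: p_def)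
  have le: "(c (p ! i), p ! i) \<le> (c (p ! j), p ! j)" if "i \<le> j" "j < ?n" for i j
    using sorted_nth_mono[OF sorted_p that(1)] that len by simp
  have pn: "p ! i < ?n" if "i < ?n" for i using st nth_mem[of i p] len that by auto
  have ne: "p ! i \<noteq> p ! Suc i" if "Suc i < ?n" for i
    using dis len that by (simp add: nth_eq_iff_index_eq)
  \<comment> \<open>The content condition of \<open>coloured_words\<close> enters here: the blocks,
    once sorted, have to form \<beta> itself.\<close>
  have "map (\<lambda>u. fst (c u)) p = \<beta>"
  proof -
    have "sorted (map (\<lambda>u. fst (c u)) p)"
      unfolding sorted_iff_nth_Suc
    proof (intro allI impI)
      fix i assume "Suc i < length (map (\<lambda>u. fst (c u)) p)"
      then show "map (\<lambda>u. fst (c u)) p ! i \<le> map (\<lambda>u. fst (c u)) p ! Suc i"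
        using le[of i "Suc i"] len by (auto simp: less_eq_prod_def less_prod_def)
    qed
    moreover have "mset (map (\<lambda>u. fst (c u)) p) = mset \<beta>"
      using c by (simp add: coloured_words_def p_def lessThan_atLeast0)
    ultimately show ?thesis using assms(1) by (metis properties_for_sort)
  qed
  then have fst_c: "fst (c (p ! i)) = \<beta> ! i" if "i < ?n" for i
    using that len by (metis nth_map)
  have choice: "c (p ! i) \<in> colour_choices \<beta> (p ! i)" if "i < ?n" for i
    using c pn[OF that] by (auto simp: coloured_words_def)
  have same_block: "\<beta> ! l = \<beta> ! i" if "f \<le> l" "l \<le> i" "\<beta> ! f = \<beta> ! i" "i < ?n" for f l i
    using sorted_nth_mono[OF assms(1), of f l] sorted_nth_mono[OF assms(1), of l i] that by simp
  have barred: "i < p ! i" if i: "i < ?n" "\<not> snd (c (p ! i))" for i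
  proof -
    define f where "f = (LEAST j. \<beta> ! j = \<beta> ! i)"
    have f: "\<beta> ! f = \<beta> ! i" "f \<le> i"
      unfolding f_def by (rule LeastI[of _ i], simp, rule Least_le, simp)
    have "l < p ! l" if "f \<le> l" "l \<le> i" for l
      using that
    proof (induction l rule: dec_induct)
      case base
      have "\<not> snd (c (p ! f))"
        using le[of f i] f i fst_c[of f] fst_c[of i] by (auto simp: less_eq_prod_def less_prod_def)
      \<comment> \<open>The barred colour requires the block to occur among the first
        \<open>p ! f\<close> positions. As \<open>f\<close> is its first position,
        \<open>f < p ! f\<close> follows.\<close>
      then have "\<beta> ! f \<in> set (take (p ! f) \<beta>)"
        using choice[of f] fst_c[of f] f i by (auto simp: colour_choices_def)
      then obtain j where j: "j < p ! f" "\<beta> ! j = \<beta> ! f" by (auto simp: in_set_conv_nth)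
      then have "f \<le> j" unfolding f_def using f by (intro Least_le) (simp add: f_def)
      then show ?case using j by simp
    next
      case (step l)
      have "\<beta> ! l = \<beta> ! i" "\<beta> ! Suc l = \<beta> ! i"
        using same_block[of f] f i step by auto
      then have "p ! l < p ! Suc l"
        using le[of l "Suc l"] le[of "Suc l" i] i step fst_c[of l] fst_c[of "Suc l"] fst_c[of i] ne[of l]
        by (auto simp: less_eq_prod_def less_prod_def)
      then show ?case using step by simp
    qed
    then show ?thesis using f by simp
  qed
  have unbarred: "p ! i \<le> i" if i: "i < ?n" "snd (c (p ! i))" for i
  proof -
    define g where "g = Max {j. j < ?n \<and> \<beta> ! j = \<beta> ! i}"
    have "g \<in> {j. j < ?n \<and> \<beta> ! j = \<beta> ! i}"
      unfolding g_def by (rule Max_in) (use i in auto)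
    then have g: "\<beta> ! g = \<beta> ! i" "g < ?n" by auto
    have g_max: "j \<le> g" if "j < ?n" "\<beta> ! j = \<beta> ! i" for j
      unfolding g_def using that by (intro Max_ge) auto
    have "p ! l \<le> l" if "i \<le> l" "l \<le> g" for l
      using that(2,1)
    proof (induction l rule: inc_induct)
      case base
      have "snd (c (p ! g))"
        using le[of i g] g i fst_c[of g] fst_c[of i] g_max[of i] by (auto simp: less_eq_prod_def less_prod_def)
      then have "\<beta> ! g \<in> set (drop (p ! g) \<beta>)"
        using choice[of g] fst_c[of g] g by (auto simp: colour_choices_def)
      then obtain j where "p ! g + j < ?n" "\<beta> ! (p ! g + j) = \<beta> ! g"
        by (auto simp: in_set_conv_nth less_diff_conv add.commute)
      then have "p ! g + j \<le> g" using g g_max by simp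
      then show ?case by simp
    next
      case (step l)
      have "\<beta> ! l = \<beta> ! i" "\<beta> ! Suc l = \<beta> ! i"
        using same_block[of i l g] same_block[of i "Suc l" g] g step by auto
      then have "p ! l < p ! Suc l"
        using le[of l "Suc l"] le[of i l] i g step fst_c[of l] fst_c[of "Suc l"] fst_c[of i] ne[of l]
        by (auto simp: less_eq_prod_def less_prod_def)
      then show ?case using step by simp
    qed
    then show ?thesis using g_max[of i] i by simp
  qed
  have c_eq: "c (p ! i) = (\<beta> ! i, p ! i \<le> i)" if "i < ?n" for i
    using fst_c[OF that] barred[OF that] unbarred[OF that]
    by (cases "c (p ! i)"; cases "snd (c (p ! i))") auto
  have w: "coloured_to_perm \<beta> c = map Suc p" by (simp add: coloured_to_perm_def p_def)
  show "c (coloured_to_perm \<beta> c ! i - 1) = (\<beta> ! i, coloured_to_perm \<beta> c ! i \<le> Suc i)" if "i < ?n"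
    using c_eq[OF that] that len by (simp add: w)
  have "dex_key (map Suc p) i \<le> dex_key (map Suc p) (Suc i)"
    if "Suc i < ?n" "\<beta> ! i = \<beta> ! Suc i" for i
    using le[of i "Suc i"] c_eq[of i] c_eq[of "Suc i"] that len
    by (auto simp: dex_key_def less_eq_prod_def less_prod_def)
  moreover have "map Suc p \<in> permutations_of_set {1..?n}"
    using st dis by (auto simp: permutations_of_set_def distinct_map image_Suc_lessThan)
  ultimately show "coloured_to_perm \<beta> c \<in> blockwise_dex_perms \<beta>"
    by (simp add: blockwise_dex_perms_def w)
qed

lemma perm_to_coloured_to_perm:
  assumes "sorted \<beta>" and c: "c \<in> coloured_words \<beta>"
  shows "perm_to_coloured \<beta> (coloured_to_perm \<beta> c) = c"
proof
  fix u
  let ?w = "coloured_to_perm \<beta> c"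
  have w: "?w \<in> permutations_of_set {1..length \<beta>}"
    using coloured_to_perm_props(1)[OF assms] by (simp add: blockwise_dex_perms_def)
  show "perm_to_coloured \<beta> ?w u = c u"
  proof (cases "u < length \<beta>")
    case True
    then have "Suc u \<in> set ?w" using w by (auto simp: permutations_of_set_def)
    then obtain i where "i < length \<beta>" "?w ! i = Suc u"
      using length_finite_permutations_of_set[OF w] by (auto simp: in_set_conv_nth)
    then show ?thesis
      using perm_to_coloured_nth[OF w, of i] coloured_to_perm_props(2)[OF assms, of i] by simp
  next
    case False
    then show ?thesis using c by (auto simp: perm_to_coloured_def coloured_words_def PiE_def extensional_def)
  qed
qed

lemma exc_eq_coloured:
  fixes t :: "'a::comm_semiring_1"
  assumes "w \<in> permutations_of_set {1..length \<beta>}"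
  shows "t ^ exc w = (\<Prod>u<length \<beta>. if snd (perm_to_coloured \<beta> w u) then 1 else t)"
proof -
  let ?n = "length \<beta>"
  have "(\<Prod>u<?n. if snd (perm_to_coloured \<beta> w u) then 1 else t)
     = prod_mset (image_mset (\<lambda>u. if snd (perm_to_coloured \<beta> w u) then 1 else t) (mset_set {..<?n}))"
    by (simp add: prod_unfold_prod_mset)
  also have "image_mset (\<lambda>u. if snd (perm_to_coloured \<beta> w u) then 1 else t) (mset_set {..<?n})
      = image_mset (\<lambda>i. if snd (perm_to_coloured \<beta> w (w ! i - 1)) then 1 else t) (mset_set {..<?n})"
    by (subst image_mset_perm[OF assms]) (simp add: image_mset.compositionality comp_def)
  also have "\<dots> = image_mset (\<lambda>i. t ^ of_bool (w ! i > Suc i)) (mset_set {..<?n})"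
    by (intro image_mset_cong) (simp add: perm_to_coloured_nth(1)[OF assms, unfolded One_nat_def])
  also have "prod_mset \<dots> = (\<Prod>i<?n. t ^ of_bool (w ! i > Suc i))"
    by (simp add: prod_unfold_prod_mset)
  also have "\<dots> = t ^ exc w"
    unfolding exc_eq_sum power_sum using length_finite_permutations_of_set[OF assms] by simp
  finally show ?thesis by simp
qed

lemma sum_blockwise_dex_perms:
  fixes t :: "'a::comm_semiring_1"
  assumes "sorted \<beta>"
  shows "(\<Sum>w\<in>blockwise_dex_perms \<beta>. t ^ exc w)
    = (\<Sum>c\<in>coloured_words \<beta>. \<Prod>u<length \<beta>. if snd (c u) then 1 else t)"
proof (rule sum.reindex_bij_witness[where i = "coloured_to_perm \<beta>" and j = "perm_to_coloured \<beta>"])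
  fix w assume w: "w \<in> blockwise_dex_perms \<beta>"
  then have perm: "w \<in> permutations_of_set {1..length \<beta>}" by (simp add: blockwise_dex_perms_def)
  show "coloured_to_perm \<beta> (perm_to_coloured \<beta> w) = w"
    by (rule coloured_to_perm_to_coloured[OF assms w])
  show "perm_to_coloured \<beta> w \<in> coloured_words \<beta>" by (rule perm_to_coloured_mem[OF perm])
  show "(\<Prod>u<length \<beta>. if snd (perm_to_coloured \<beta> w u) then 1 else t) = t ^ exc w"
    by (rule exc_eq_coloured[OF perm, symmetric])
qed (use assms in \<open>simp_all add: coloured_to_perm_props perm_to_coloured_to_perm\<close>)

section \<open>Generating polynomials whose monomials are contents\<close>

type_synonym 'a mpoly = "nat multiset \<Rightarrow>\<^sub>0 'a"

abbreviation mpoly_term :: "nat multiset \<Rightarrow> 'a::zero \<Rightarrow> 'a mpoly" where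
  "mpoly_term \<equiv> Poly_Mapping.single"

abbreviation coeff_of :: "'a::zero mpoly \<Rightarrow> nat multiset \<Rightarrow> 'a" where
  "coeff_of \<equiv> Poly_Mapping.lookup"

lemma prod_monom:
  fixes c :: "'b \<Rightarrow> 'a::comm_semiring_1"
  shows "(\<Prod>i\<in>A. mpoly_term (M i) (c i)) = mpoly_term (\<Sum>i\<in>A. M i) (\<Prod>i\<in>A. c i)"
proof (induction A rule: infinite_finite_induct)
  case (insert x A)
  then show ?case by (simp add: mult_single)
qed (simp_all flip: single_one)

text \<open>Each factor lists the weighted colours open to one value, so expanding the product runs
  through all colourings. The monomial of a colouring is its content, and the coefficient at
  \<open>mset \<beta>\<close> selects the coloured words.\<close>

lemma sum_blockwise_dex_perms_coeff:
  fixes t :: "'a::comm_semiring_1"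
  assumes "sorted \<beta>"
  shows "(\<Sum>w\<in>blockwise_dex_perms \<beta>. t ^ exc w)
    = coeff_of (\<Prod>u<length \<beta>. (\<Sum>y\<in>set (take u \<beta>). mpoly_term {#y#} t) + (\<Sum>y\<in>set (drop u \<beta>). mpoly_term {#y#} 1)) (mset \<beta>)"
proof -
  let ?n = "length \<beta>" and ?m = "\<lambda>z. mpoly_term {#fst z#} (if snd z then 1 else t)"
  have choices: "(\<Sum>y\<in>set (take u \<beta>). mpoly_term {#y#} t) + (\<Sum>y\<in>set (drop u \<beta>). mpoly_term {#y#} 1)
     = (\<Sum>z\<in>colour_choices \<beta> u. ?m z)" for u
  proof -
    have "(\<Sum>z\<in>A \<times> {b}. ?m z) = (\<Sum>y\<in>A. ?m (y, b))" for A b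
      by (rule sum.reindex_bij_witness[of _ "\<lambda>y. (y, b)" fst]) auto
    then show ?thesis
      unfolding colour_choices_def by (subst sum.union_disjoint) auto
  qed
  have content: "(\<Sum>u<?n. {#fst (c u)#}) = image_mset (\<lambda>u. fst (c u)) (mset_set {..<?n})" for c :: "nat \<Rightarrow> nat \<times> bool"
    by (simp add: sum_unfold_sum_mset image_mset.compositionality comp_def)
  have fin: "finite (Pi\<^sub>E {..<?n} (colour_choices \<beta>))"
    by (intro finite_PiE) (auto simp: colour_choices_def)
  have "(\<Prod>u<?n. \<Sum>z\<in>colour_choices \<beta> u. ?m z)
     = (\<Sum>c\<in>Pi\<^sub>E {..<?n} (colour_choices \<beta>). \<Prod>u<?n. ?m (c u))"
    by (rule prod_sum_PiE) (auto simp: colour_choices_def)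
  also have "\<dots> = (\<Sum>c\<in>Pi\<^sub>E {..<?n} (colour_choices \<beta>).
      mpoly_term (image_mset (\<lambda>u. fst (c u)) (mset_set {..<?n})) (\<Prod>u<?n. if snd (c u) then 1 else t))"
    by (simp add: prod_monom content)
  finally show ?thesis
    unfolding choices sum_blockwise_dex_perms[OF assms] coloured_words_def
    using fin by (simp add: lookup_sum lookup_single sum.inter_filter when_def)
qed

section \<open>The recurrence for the coefficients\<close>

lemma finite_submultisets [simp]: "finite {\<kappa>. \<kappa> \<subseteq># \<mu>}"
proof (rule finite_surj)
  show "finite {xs. set xs \<subseteq> set_mset \<mu> \<and> length xs \<le> size \<mu>}"
    by (rule finite_lists_length_le) simp
  show "{\<kappa>. \<kappa> \<subseteq># \<mu>} \<subseteq> mset ` {xs. set xs \<subseteq> set_mset \<mu> \<and> length xs \<le> size \<mu>}"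
  proof
    fix \<kappa> assume \<kappa>: "\<kappa> \<in> {\<kappa>. \<kappa> \<subseteq># \<mu>}"
    obtain xs where xs: "mset xs = \<kappa>" using ex_mset by blast
    have "set_mset \<kappa> \<subseteq> set_mset \<mu>" "size \<kappa> \<le> size \<mu>"
      using \<kappa> by (auto dest: size_mset_mono mset_subset_eqD)
    then show "\<kappa> \<in> mset ` {xs. set xs \<subseteq> set_mset \<mu> \<and> length xs \<le> size \<mu>}"
      using xs by (intro image_eqI[where x = xs]) auto
  qed
qed

text \<open>Choosing a number \<open>k \<le> count \<mu> i\<close> for every \<open>i\<close>
  amounts to choosing a submultiset of \<mu>; letters of \<open>B\<close> outside \<mu> leave only
  \<open>k = 0\<close>.\<close>

lemma prod_sum_submultisets:
  fixes f :: "'b \<Rightarrow> nat \<Rightarrow> nat \<Rightarrow> 'a::comm_semiring_1"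
  assumes "finite B" "set_mset \<mu> \<subseteq> B"
  shows "(\<Prod>i\<in>B. \<Sum>k\<le>count \<mu> i. f i k (count \<mu> i - k))
    = (\<Sum>\<kappa>\<in>{\<kappa>. \<kappa> \<subseteq># \<mu>}. \<Prod>i\<in>B. f i (count \<kappa> i) (count (\<mu> - \<kappa>) i))"
proof -
  have cnt: "count (\<Sum>i\<in>B. replicate_mset (g i) i) j = (if j \<in> B then g j else 0)" for g :: "'b \<Rightarrow> nat" and j
    using assms(1) by (simp add: count_sum sum.delta)
  have "(\<Prod>i\<in>B. \<Sum>k\<le>count \<mu> i. f i k (count \<mu> i - k))
     = (\<Sum>g\<in>Pi\<^sub>E B (\<lambda>i. {..count \<mu> i}). \<Prod>i\<in>B. f i (g i) (count \<mu> i - g i))"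
    using assms(1) by (intro prod_sum_PiE) auto
  also have "\<dots> = (\<Sum>\<kappa>\<in>{\<kappa>. \<kappa> \<subseteq># \<mu>}. \<Prod>i\<in>B. f i (count \<kappa> i) (count (\<mu> - \<kappa>) i))"
  proof (rule sum.reindex_bij_witness[where i = "\<lambda>\<kappa>. restrict (count \<kappa>) B"
        and j = "\<lambda>g. \<Sum>i\<in>B. replicate_mset (g i) i"])
    fix g assume g: "g \<in> Pi\<^sub>E B (\<lambda>i. {..count \<mu> i})"
    show "restrict (count (\<Sum>i\<in>B. replicate_mset (g i) i)) B = g"
      using g by (auto simp: cnt fun_eq_iff PiE_def extensional_def)
    show "(\<Sum>i\<in>B. replicate_mset (g i) i) \<in> {\<kappa>. \<kappa> \<subseteq># \<mu>}"
      using g by (auto simp: subseteq_mset_def cnt PiE_def Pi_def)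
    show "(\<Prod>i\<in>B. f i (count (\<Sum>i\<in>B. replicate_mset (g i) i) i) (count (\<mu> - (\<Sum>i\<in>B. replicate_mset (g i) i)) i))
        = (\<Prod>i\<in>B. f i (g i) (count \<mu> i - g i))"
      by (intro prod.cong) (simp_all add: cnt)
  next
    fix \<kappa> assume \<kappa>: "\<kappa> \<in> {\<kappa>. \<kappa> \<subseteq># \<mu>}"
    show "restrict (count \<kappa>) B \<in> Pi\<^sub>E B (\<lambda>i. {..count \<mu> i})"
      using \<kappa> by (auto simp: subseteq_mset_def)
    show "(\<Sum>i\<in>B. replicate_mset (restrict (count \<kappa>) B i) i) = \<kappa>"
    proof (rule multiset_eqI)
      fix j
      have "j \<in> B" if "j \<in># \<kappa>" using \<kappa> that assms(2) by (auto dest: mset_subset_eqD)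
      then show "count (\<Sum>i\<in>B. replicate_mset (restrict (count \<kappa>) B i) i) j = count \<kappa> j"
        by (cases "j \<in> B") (auto simp: cnt count_eq_zero_iff)
    qed
  qed
  finally show ?thesis .
qed

lemma coeff_monom_mult:
  "coeff_of (mpoly_term \<kappa> c * p) \<mu> = (if \<kappa> \<subseteq># \<mu> then c * coeff_of p (\<mu> - \<kappa>) else 0)"
proof -
  have eq: "\<mu> = \<kappa> + r \<longleftrightarrow> \<kappa> \<subseteq># \<mu> \<and> r = \<mu> - \<kappa>" for r
    by (auto simp: subset_mset.add_diff_inverse)
  have "coeff_of (mpoly_term \<kappa> c * p) \<mu> = c * Sum_any (\<lambda>r. coeff_of p r when \<mu> = \<kappa> + r)"
    by (simp add: lookup_mult lookup_single when_mult)
  then show ?thesis by (auto simp: eq)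
qed

text \<open>A monomial in the variables of \<open>S\<close> factors only into monomials in these
  variables. This later allows an alphabet to be replaced by \<open>set_mset \<mu>\<close>.\<close>

lemma coeff_mult_cong:
  assumes p: "\<And>\<nu>. set_mset \<nu> \<subseteq> S \<Longrightarrow> coeff_of p \<nu> = coeff_of p' \<nu>"
    and q: "\<And>\<nu>. set_mset \<nu> \<subseteq> S \<Longrightarrow> coeff_of q \<nu> = coeff_of q' \<nu>"
    and \<mu>: "set_mset \<mu> \<subseteq> S"
  shows "coeff_of (p * q) \<mu> = coeff_of (p' * q') \<mu>"
proof -
  have "coeff_of p a * Sum_any (\<lambda>b. coeff_of q b when \<mu> = a + b)
    = coeff_of p' a * Sum_any (\<lambda>b. coeff_of q' b when \<mu> = a + b)" for a
  proof (cases "a \<subseteq># \<mu>")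
    case True
    then have "coeff_of p a = coeff_of p' a"
      using \<mu> by (intro p) (auto dest: mset_subset_eqD)
    moreover have "(coeff_of q b when \<mu> = a + b) = (coeff_of q' b when \<mu> = a + b)" for b
      using \<mu> by (intro when_cong refl q) auto
    ultimately show ?thesis by simp
  next
    case False
    then have "\<mu> \<noteq> a + b" for b by auto
    then show ?thesis by simp
  qed
  then show ?thesis by (simp add: lookup_mult)
qed

lemma coeff_prod_cong:
  fixes p p' :: "'b \<Rightarrow> 'a::comm_semiring_1 mpoly"
  assumes "\<And>i \<nu>. i \<in> A \<Longrightarrow> set_mset \<nu> \<subseteq> S \<Longrightarrow> coeff_of (p i) \<nu> = coeff_of (p' i) \<nu>"
    and "set_mset \<mu> \<subseteq> S"
  shows "coeff_of (\<Prod>i\<in>A. p i) \<mu> = coeff_of (\<Prod>i\<in>A. p' i) \<mu>"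
  using assms
proof (induction A arbitrary: \<mu> rule: infinite_finite_induct)
  case (insert x A)
  show ?case
    unfolding prod.insert[OF insert.hyps]
    by (rule coeff_mult_cong[where S = S]) (use insert in auto)
qed auto

lemma coeff_power_cong:
  fixes p p' :: "'a::comm_semiring_1 mpoly"
  assumes "\<And>\<nu>. set_mset \<nu> \<subseteq> S \<Longrightarrow> coeff_of p \<nu> = coeff_of p' \<nu>" and "set_mset \<mu> \<subseteq> S"
  shows "coeff_of (p ^ k) \<mu> = coeff_of (p' ^ k) \<mu>"
proof -
  have "coeff_of (\<Prod>i<k. p) \<mu> = coeff_of (\<Prod>i<k. p') \<mu>"
    by (rule coeff_prod_cong[where S = S]) (use assms in blast)+
  then show ?thesis by simp
qed

section \<open>Linear forms of the rows of the weight matrix\<close>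

definition vars :: "'a::comm_semiring_1 \<Rightarrow> nat set \<Rightarrow> 'a mpoly" where
  "vars c U = (\<Sum>y\<in>U. mpoly_term {#y#} c)"

lemma vars_insert:
  "finite U \<Longrightarrow> y \<notin> U \<Longrightarrow> vars c (insert y U) = mpoly_term {#y#} c + vars c U"
  by (simp add: vars_def)

lemma coeff_vars_cong:
  assumes "finite U" "finite U'" "U \<inter> S = U' \<inter> S" "set_mset \<nu> \<subseteq> S"
  shows "coeff_of (vars c U) \<nu> = coeff_of (vars c U') \<nu>"
proof -
  have "coeff_of (vars c U) \<nu> = (\<Sum>y\<in>U \<inter> S. coeff_of (mpoly_term {#y#} c) \<nu>)" if "finite U" for U
    unfolding vars_def lookup_sum
    by (rule sum.mono_neutral_right) (use that assms(4) in \<open>auto simp: lookup_single when_def\<close>)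
  then show ?thesis using assms by metis
qed

text \<open>The row sums of the matrix of weights of pairs (block of a value, letter): \<open>t\<close> below the
  diagonal, \<open>1\<close> above it, and \<open>1 + t\<close>, \<open>1\<close> or \<open>t\<close> on it.\<close>

definition row_both :: "'a::comm_semiring_1 \<Rightarrow> nat set \<Rightarrow> nat \<Rightarrow> 'a mpoly" where
  "row_both t B i = vars t {y\<in>B. y \<le> i} + vars 1 {y\<in>B. i \<le> y}"

definition row_exc :: "'a::comm_semiring_1 \<Rightarrow> nat set \<Rightarrow> nat \<Rightarrow> 'a mpoly" where
  "row_exc t B i = vars t {y\<in>B. y < i} + vars 1 {y\<in>B. i \<le> y}"

definition row_wexc :: "'a::comm_semiring_1 \<Rightarrow> nat set \<Rightarrow> nat \<Rightarrow> 'a mpoly" where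
  "row_wexc t B i = vars t {y\<in>B. y \<le> i} + vars 1 {y\<in>B. i < y}"

lemma row_both_eq:
  assumes "finite B" "i \<in> B"
  shows "row_both t B i = mpoly_term {#i#} t + row_exc t B i"
    and "row_both t B i = mpoly_term {#i#} 1 + row_wexc t B i"
proof -
  have "{y\<in>B. y \<le> i} = insert i {y\<in>B. y < i}" "{y\<in>B. i \<le> y} = insert i {y\<in>B. i < y}"
    using assms by auto
  then show "row_both t B i = mpoly_term {#i#} t + row_exc t B i"
    and "row_both t B i = mpoly_term {#i#} 1 + row_wexc t B i"
    using assms(1) by (simp_all add: row_both_def row_exc_def row_wexc_def vars_insert add_ac)
qed

text \<open>Two neighbouring rows share a weight, so the two products differ in one factor only.\<close>

lemma prod_row_wexc:
  assumes "finite B" "B \<noteq> {}"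
  shows "(\<Prod>i\<in>B. row_wexc t B i) = mpoly_term {#} t * (\<Prod>i\<in>B. row_exc t B i)"
proof -
  \<comment> \<open>\<open>A\<close> runs through the initial segments of \<open>B\<close>. The
    \<open>row_exc\<close> of a new largest element equals the \<open>row_wexc\<close> of the
    element before it, and this common factor goes into \<open>Z\<close>; only the first
    \<open>row_exc\<close> and the last \<open>row_wexc\<close> stay outside.\<close>
  have "A \<subseteq> B \<Longrightarrow> (\<forall>a\<in>A. \<forall>b\<in>B - A. a < b) \<Longrightarrow> A \<noteq> {} \<Longrightarrow>
    \<exists>Z. (\<Prod>i\<in>A. row_wexc t B i) = (vars t A + vars 1 (B - A)) * Z \<and> (\<Prod>i\<in>A. row_exc t B i) = vars 1 B * Z"
    if "finite A" for A
    using that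
  proof (induction A rule: finite_linorder_max_induct)
    case (insert b A)
    have b: "b \<in> B" "b \<notin> A" "A \<subseteq> B" using insert by auto
    have "y \<in> A" if "y \<in> B" "y < b" for y
    proof (rule ccontr)
      assume "y \<notin> A"
      then have "b < y" using that insert.prems(2) by auto
      then show False using that by simp
    qed
    then have below: "{y\<in>B. y < b} = A" using insert.hyps b by auto
    have "{y\<in>B. y \<le> b} = insert b A" using below b by (auto simp: le_less)
    then have w: "row_wexc t B b = vars t (insert b A) + vars 1 (B - insert b A)"
      unfolding row_wexc_def by (intro arg_cong2[where f = "(+)"] arg_cong[where f = "vars _"]) (auto simp: not_le[symmetric])
    have e: "row_exc t B b = vars t A + vars 1 (B - A)"
      unfolding row_exc_def below
      by (intro arg_cong2[where f = "(+)"] arg_cong[where f = "vars _"] refl) (use below in auto)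
    show ?case
    proof (cases "A = {}")
      case True
      then show ?thesis using w e by (auto simp: vars_def intro!: exI[of _ 1])
    next
      case False
      have "a < x" if "a \<in> A" "x \<in> B - A" for a x
        using that insert.prems(2) insert.hyps(2) by (cases "x = b") auto
      then have "\<forall>a\<in>A. \<forall>b\<in>B - A. a < b" by blast
      then obtain Z where Z: "(\<Prod>i\<in>A. row_wexc t B i) = (vars t A + vars 1 (B - A)) * Z"
          "(\<Prod>i\<in>A. row_exc t B i) = vars 1 B * Z"
        using insert.IH[OF b(3) _ False] by auto
      then show ?thesis
        using insert.hyps b w e
        by (intro exI[of _ "(vars t A + vars 1 (B - A)) * Z"]) (simp add: mult_ac)
    qed
  qed simp
  then obtain Z where "(\<Prod>i\<in>B. row_wexc t B i) = (vars t B + vars 1 (B - B)) * Z"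
      "(\<Prod>i\<in>B. row_exc t B i) = vars 1 B * Z"
    using assms by blast
  \<comment> \<open>For \<open>A = B\<close> the two factors outside \<open>Z\<close> are the forms
    with all weights \<open>t\<close> and with all weights 1; \<open>mpoly_term {#} t\<close> is the
    constant \<open>t\<close>.\<close>
  moreover have "vars t B = mpoly_term {#} t * vars 1 B"
    by (simp add: vars_def sum_distrib_left mult_single)
  ultimately show ?thesis by (simp add: vars_def mult.assoc)
qed

text \<open>The contribution of a block of \<open>p\<close> values: one of them has the factor
  \<open>Z\<close>, in the applications a row with its own block in one colour only, and the others
  have \<open>L\<close>, with both colours.\<close>

definition block_poly :: "'a::comm_semiring_1 \<Rightarrow> 'a \<Rightarrow> nat \<Rightarrow> 'a" where
  "block_poly L Z p = (if p = 0 then 1 else L ^ (p - 1) * Z)"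

text \<open>Expand the power from the left up to the first factor that contributes \<open>Z\<close>:
  it is preceded by \<open>k\<close> factors \<open>a\<close> and followed by
  \<open>p - k - 1\<close> unexpanded ones. The term \<open>k = p\<close> has no such
  factor.\<close>

lemma power_eq_sum_block_poly:
  fixes a :: "'a::comm_semiring_1"
  shows "(a + Z) ^ p = (\<Sum>k\<le>p. a ^ k * block_poly (a + Z) Z (p - k))"
proof (induction p)
  case (Suc p)
  have "(a + Z) ^ Suc p = (a + Z) ^ p * Z + a * (a + Z) ^ p" by (simp add: algebra_simps)
  also have "a * (a + Z) ^ p = (\<Sum>k\<le>p. a ^ Suc k * block_poly (a + Z) Z (p - k))"
    by (subst Suc.IH) (simp add: sum_distrib_left mult_ac)
  finally show ?case
    by (subst sum.atMost_Suc_shift) (simp add: block_poly_def)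
qed (simp add: block_poly_def)

text \<open>This is \<open>N(\<mu>)\<close> of the overview, and \<open>wexc_coeff\<close> is
  \<open>M(\<mu>)\<close>. The alphabet \<open>B\<close> may exceed the support of \<mu>, so that it
  can stay fixed while \<mu> shrinks.\<close>

definition exc_coeff :: "'a::comm_semiring_1 \<Rightarrow> nat set \<Rightarrow> nat multiset \<Rightarrow> 'a" where
  "exc_coeff t B \<mu> = coeff_of (\<Prod>i\<in>B. block_poly (row_both t B i) (row_exc t B i) (count \<mu> i)) \<mu>"

definition wexc_coeff :: "'a::comm_semiring_1 \<Rightarrow> nat set \<Rightarrow> nat multiset \<Rightarrow> 'a" where
  "wexc_coeff t B \<mu> = coeff_of (\<Prod>i\<in>B. block_poly (row_both t B i) (row_wexc t B i) (count \<mu> i)) \<mu>"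

lemma exc_coeff_empty: "exc_coeff t B {#} = 1" "wexc_coeff t B {#} = 1"
  by (simp_all add: exc_coeff_def wexc_coeff_def block_poly_def lookup_one)

lemma prod_single_power:
  assumes "finite B" "set_mset \<kappa> \<subseteq> B"
  shows "(\<Prod>i\<in>B. mpoly_term {#i#} c ^ count \<kappa> i) = mpoly_term \<kappa> (c ^ size \<kappa>)"
  using assms(2)
proof (induction \<kappa>)
  case empty
  then show ?case by simp
next
  case (add x \<kappa>)
  then have x: "x \<in> B" by simp
  have "(\<Prod>i\<in>B. mpoly_term {#i#} c ^ count (add_mset x \<kappa>) i)
     = mpoly_term {#x#} c ^ Suc (count \<kappa> x) * (\<Prod>i\<in>B - {x}. mpoly_term {#i#} c ^ count \<kappa> i)"
    using assms(1) x by (simp add: prod.remove[of B x])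
  also have "\<dots> = mpoly_term {#x#} c * (\<Prod>i\<in>B. mpoly_term {#i#} c ^ count \<kappa> i)"
    using assms(1) x by (simp add: prod.remove[of B x] mult.assoc)
  finally show ?case using add by (simp add: mult_single)
qed

text \<open>\<open>power_eq_sum_block_poly\<close> is applied to all rows at once. The numbers of
  split-off letters form \<kappa>, whose monomial is pulled out and leaves a coefficient at
  \<open>\<mu> - \<kappa>\<close>.\<close>

lemma coeff_prod_row_both:
  assumes "finite B" "set_mset \<mu> \<subseteq> B"
    and row: "\<And>i. i \<in> B \<Longrightarrow> row_both t B i = mpoly_term {#i#} c + Z i"
  shows "coeff_of (\<Prod>i\<in>B. row_both t B i ^ count \<mu> i) \<mu>
    = (\<Sum>\<kappa>\<in>{\<kappa>. \<kappa> \<subseteq># \<mu>}. c ^ size \<kappa> *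
         coeff_of (\<Prod>i\<in>B. block_poly (row_both t B i) (Z i) (count (\<mu> - \<kappa>) i)) (\<mu> - \<kappa>))"
proof -
  have "(\<Prod>i\<in>B. row_both t B i ^ count \<mu> i)
      = (\<Prod>i\<in>B. \<Sum>k\<le>count \<mu> i. mpoly_term {#i#} c ^ k * block_poly (row_both t B i) (Z i) (count \<mu> i - k))"
    by (intro prod.cong refl) (simp add: row power_eq_sum_block_poly)
  also have "\<dots> = (\<Sum>\<kappa>\<in>{\<kappa>. \<kappa> \<subseteq># \<mu>}. \<Prod>i\<in>B. mpoly_term {#i#} c ^ count \<kappa> i *
        block_poly (row_both t B i) (Z i) (count (\<mu> - \<kappa>) i))"
    using assms(1,2) by (rule prod_sum_submultisets)
  also have "\<dots> = (\<Sum>\<kappa>\<in>{\<kappa>. \<kappa> \<subseteq># \<mu>}. mpoly_term \<kappa> (c ^ size \<kappa>) *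
        (\<Prod>i\<in>B. block_poly (row_both t B i) (Z i) (count (\<mu> - \<kappa>) i)))"
  proof (rule sum.cong[OF refl])
    fix \<kappa> assume "\<kappa> \<in> {\<kappa>. \<kappa> \<subseteq># \<mu>}"
    then have "set_mset \<kappa> \<subseteq> B" using assms(2) by (auto dest: mset_subset_eqD)
    then show "(\<Prod>i\<in>B. mpoly_term {#i#} c ^ count \<kappa> i * block_poly (row_both t B i) (Z i) (count (\<mu> - \<kappa>) i))
      = mpoly_term \<kappa> (c ^ size \<kappa>) * (\<Prod>i\<in>B. block_poly (row_both t B i) (Z i) (count (\<mu> - \<kappa>) i))"
      using assms(1) by (simp add: prod.distrib prod_single_power)
  qed
  finally show ?thesis by (simp add: lookup_sum coeff_monom_mult)
qed

text \<open>An absent letter contributes an empty block, and its variable does not divide the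
  monomial \<mu>. Over the alphabet \<open>set_mset \<mu>\<close> every row contributes exactly one
  \<open>Z\<close>, which is the situation of \<open>prod_row_wexc\<close>.\<close>

lemma coeff_rows_restrict:
  assumes "finite B" "set_mset \<mu> \<subseteq> B"
  shows "exc_coeff t B \<mu> = exc_coeff t (set_mset \<mu>) \<mu>" "wexc_coeff t B \<mu> = wexc_coeff t (set_mset \<mu>) \<mu>"
proof -
  let ?S = "set_mset \<mu>"
  have cong: "coeff_of (\<Prod>i\<in>B. block_poly (row_both t B i) (Z i) (count \<mu> i)) \<mu>
    = coeff_of (\<Prod>i\<in>?S. block_poly (row_both t ?S i) (Z' i) (count \<mu> i)) \<mu>"
    if Z: "\<And>i \<nu>. set_mset \<nu> \<subseteq> ?S \<Longrightarrow> coeff_of (Z i) \<nu> = coeff_of (Z' i) \<nu>" for Z Z' :: "nat \<Rightarrow> 'a mpoly"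
  proof -
    have "(\<Prod>i\<in>B. block_poly (row_both t B i) (Z i) (count \<mu> i)) = (\<Prod>i\<in>?S. block_poly (row_both t B i) (Z i) (count \<mu> i))"
      using assms by (intro prod.mono_neutral_right) (auto simp: block_poly_def not_in_iff)
    also have "coeff_of \<dots> \<mu> = coeff_of (\<Prod>i\<in>?S. block_poly (row_both t ?S i) (Z' i) (count \<mu> i)) \<mu>"
    proof (rule coeff_prod_cong[where S = ?S])
      fix i \<nu> assume "i \<in> ?S" and \<nu>: "set_mset \<nu> \<subseteq> ?S"
      have "coeff_of (row_both t B i) \<nu>' = coeff_of (row_both t ?S i) \<nu>'" if "set_mset \<nu>' \<subseteq> ?S" for \<nu>'
        unfolding row_both_def lookup_add
        by (intro arg_cong2[where f = "(+)"] coeff_vars_cong[where S = ?S]) (use assms that in auto)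
      then have "coeff_of (row_both t B i ^ (count \<mu> i - 1) * Z i) \<nu> = coeff_of (row_both t ?S i ^ (count \<mu> i - 1) * Z' i) \<nu>"
        using \<nu> Z by (intro coeff_mult_cong[where S = ?S] coeff_power_cong[where S = ?S])
      then show "coeff_of (block_poly (row_both t B i) (Z i) (count \<mu> i)) \<nu>
        = coeff_of (block_poly (row_both t ?S i) (Z' i) (count \<mu> i)) \<nu>"
        using \<open>i \<in> ?S\<close> by (simp add: block_poly_def count_eq_zero_iff)
    qed simp
    finally show ?thesis .
  qed
  show "exc_coeff t B \<mu> = exc_coeff t ?S \<mu>"
    unfolding exc_coeff_def
    by (rule cong, unfold row_exc_def lookup_add,
        intro arg_cong2[where f = "(+)"] coeff_vars_cong[where S = ?S]) (use assms in auto)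
  show "wexc_coeff t B \<mu> = wexc_coeff t ?S \<mu>"
    unfolding wexc_coeff_def
    by (rule cong, unfold row_wexc_def lookup_add,
        intro arg_cong2[where f = "(+)"] coeff_vars_cong[where S = ?S]) (use assms in auto)
qed

lemma wexc_coeff_eq:
  assumes "finite B" "set_mset \<mu> \<subseteq> B" "\<mu> \<noteq> {#}"
  shows "wexc_coeff t B \<mu> = t * exc_coeff t B \<mu>"
proof -
  let ?S = "set_mset \<mu>"
  have block: "(\<Prod>i\<in>?S. block_poly (row_both t ?S i) (Z i) (count \<mu> i))
     = (\<Prod>i\<in>?S. row_both t ?S i ^ (count \<mu> i - 1)) * (\<Prod>i\<in>?S. Z i)" for Z
    by (subst prod.distrib[symmetric], rule prod.cong) (auto simp: block_poly_def count_eq_zero_iff)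
  have "(\<Prod>i\<in>?S. block_poly (row_both t ?S i) (row_wexc t ?S i) (count \<mu> i))
     = mpoly_term {#} t * (\<Prod>i\<in>?S. block_poly (row_both t ?S i) (row_exc t ?S i) (count \<mu> i))"
    unfolding block using assms(3) by (subst prod_row_wexc) (simp_all add: mult_ac)
  then have "wexc_coeff t ?S \<mu> = t * exc_coeff t ?S \<mu>"
    by (simp add: wexc_coeff_def exc_coeff_def coeff_monom_mult)
  then show ?thesis using coeff_rows_restrict[OF assms(1,2)] by metis
qed

lemma exc_coeff_recurrence:
  fixes t :: "'a::comm_ring_1"
  assumes "finite B" "set_mset \<mu> \<subseteq> B"
  shows "(\<Sum>\<kappa>\<in>{\<kappa>. \<kappa> \<subseteq># \<mu>}. (t ^ size \<kappa> - t) * exc_coeff t B (\<mu> - \<kappa>)) = 1 - t"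
proof -
  let ?K = "{\<kappa>. \<kappa> \<subseteq># \<mu>}"
  have "(\<Sum>\<kappa>\<in>?K. t ^ size \<kappa> * exc_coeff t B (\<mu> - \<kappa>)) = (\<Sum>\<kappa>\<in>?K. 1 ^ size \<kappa> * wexc_coeff t B (\<mu> - \<kappa>))"
    unfolding exc_coeff_def wexc_coeff_def
    by (rule trans[OF coeff_prod_row_both[where c = t, symmetric] coeff_prod_row_both[where c = 1]])
      (use assms row_both_eq[OF assms(1)] in blast)+
  \<comment> \<open>\<open>wexc_coeff_eq\<close> is for non-empty contents. At
    \<open>\<kappa> = \<mu>\<close> both coefficients are 1, and this term is the source of
    \<open>1 - t\<close>.\<close>
  also have "\<dots> = (\<Sum>\<kappa>\<in>?K - {\<mu>}. wexc_coeff t B (\<mu> - \<kappa>)) + 1"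
    by (simp add: sum.remove[of ?K \<mu>] exc_coeff_empty)
  also have "(\<Sum>\<kappa>\<in>?K - {\<mu>}. wexc_coeff t B (\<mu> - \<kappa>)) = (\<Sum>\<kappa>\<in>?K - {\<mu>}. t * exc_coeff t B (\<mu> - \<kappa>))"
  proof (rule sum.cong[OF refl])
    fix \<kappa> assume "\<kappa> \<in> ?K - {\<mu>}"
    then have "\<mu> - \<kappa> \<noteq> {#}" using subset_mset.diff_add[of \<kappa> \<mu>] by fastforce
    then show "wexc_coeff t B (\<mu> - \<kappa>) = t * exc_coeff t B (\<mu> - \<kappa>)"
      using assms by (intro wexc_coeff_eq) (auto dest: in_diffD)
  qed
  also have "(\<Sum>\<kappa>\<in>?K - {\<mu>}. t * exc_coeff t B (\<mu> - \<kappa>)) = (\<Sum>\<kappa>\<in>?K. t * exc_coeff t B (\<mu> - \<kappa>)) - t"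
    by (simp add: sum.remove[of ?K \<mu>] exc_coeff_empty)
  finally show ?thesis by (simp add: left_diff_distrib sum_subtractf)
qed

text \<open>The factors are grouped by block. For a position \<open>u\<close> of block
  \<open>i\<close>, the letter \<open>i\<close> always occurs in \<open>drop u \<beta>\<close>, and
  it occurs in \<open>take u \<beta>\<close> unless \<open>u\<close> is the first position of the
  block. So one factor is \<open>row_exc\<close> and the others are \<open>row_both\<close>.\<close>

lemma prod_rows_sorted:
  fixes t :: "'a::comm_semiring_1"
  assumes "sorted \<beta>"
  shows "(\<Prod>u<length \<beta>. (\<Sum>y\<in>set (take u \<beta>). mpoly_term {#y#} t) + (\<Sum>y\<in>set (drop u \<beta>). mpoly_term {#y#} 1))
    = (\<Prod>i\<in>set \<beta>. block_poly (row_both t (set \<beta>) i) (row_exc t (set \<beta>) i) (count (mset \<beta>) i))"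
proof -
  let ?n = "length \<beta>" and ?B = "set \<beta>"
  let ?L = "\<lambda>u. vars t (set (take u \<beta>)) + vars 1 (set (drop u \<beta>))"
  have "(\<Prod>u<?n. ?L u) = (\<Prod>i\<in>?B. \<Prod>u\<in>{u\<in>{..<?n}. \<beta> ! u = i}. ?L u)"
    by (rule prod.group[symmetric]) auto
  also have "\<dots> = (\<Prod>i\<in>?B. block_poly (row_both t ?B i) (row_exc t ?B i) (count (mset \<beta>) i))"
  proof (rule prod.cong[OF refl])
    fix i assume "i \<in> ?B"
    define U where "U = {u\<in>{..<?n}. \<beta> ! u = i}"
    have "U \<noteq> {}" using \<open>i \<in> ?B\<close> by (auto simp: U_def in_set_conv_nth)
    define f where "f = Min U"
    have fin: "finite U" by (simp add: U_def)
    have f: "f \<in> U" "\<And>u. u \<in> U \<Longrightarrow> f \<le> u"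
      using fin \<open>U \<noteq> {}\<close> by (auto simp: f_def)
    have card: "card U = count (mset \<beta>) i"
      unfolding count_mset count_list_eq_length_filter length_filter_conv_card U_def by (rule arg_cong[where f = card]) auto
    have mono: "\<beta> ! j \<le> \<beta> ! k" if "j \<le> k" "k < ?n" for j k
      using assms that by (rule sorted_nth_mono)
    have drop: "set (drop u \<beta>) = {y\<in>?B. i \<le> y}" if "u \<in> U" for u
    proof (intro equalityI subsetI)
      fix y assume "y \<in> set (drop u \<beta>)"
      then obtain j where "j < length (drop u \<beta>)" "drop u \<beta> ! j = y"
        unfolding in_set_conv_nth by blast
      then have "u + j < ?n" "y = \<beta> ! (u + j)" by auto
      then show "y \<in> {y\<in>?B. i \<le> y}" using that mono[of u "u + j"] by (auto simp: U_def)
    next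
      fix y assume "y \<in> {y\<in>?B. i \<le> y}"
      then obtain j where j: "j < ?n" "y = \<beta> ! j" "i \<le> y" by (auto simp: in_set_conv_nth)
      define k where "k = max u j"
      have "y = \<beta> ! k" using j that mono[of j u] by (auto simp: k_def U_def max_def)
      moreover have "k < ?n" "u \<le> k" using j that by (auto simp: k_def U_def)
      ultimately show "y \<in> set (drop u \<beta>)"
        by (auto simp: in_set_conv_nth intro!: exI[of _ "k - u"])
    qed
    have take: "y \<in> set (take u \<beta>) \<longleftrightarrow> (\<exists>j<u. y = \<beta> ! j)" if "u \<in> U" for u y
      using that by (auto simp: in_set_conv_nth U_def)
    have take_f: "set (take f \<beta>) = {y\<in>?B. y < i}"
    proof (intro equalityI subsetI)
      fix y assume "y \<in> set (take f \<beta>)"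
      then obtain j where j: "j < f" "y = \<beta> ! j" using take f by auto
      then have "j \<notin> U" using f(2)[of j] by auto
      then show "y \<in> {y\<in>?B. y < i}" using j f mono[of j f] by (auto simp: U_def)
    next
      fix y assume "y \<in> {y\<in>?B. y < i}"
      then obtain j where j: "j < ?n" "y = \<beta> ! j" "y < i" by (auto simp: in_set_conv_nth)
      then have "j < f" using mono[of f j] f by (cases "j < f") (auto simp: U_def)
      then show "y \<in> set (take f \<beta>)" using take f j by auto
    qed
    have take_U: "set (take u \<beta>) = {y\<in>?B. y \<le> i}" if "u \<in> U - {f}" for u
    proof (intro equalityI subsetI)
      fix y assume "y \<in> set (take u \<beta>)"
      moreover have "u \<in> U" using that by simp
      ultimately obtain j where "j < u" "y = \<beta> ! j" using take by blast
      then show "y \<in> {y\<in>?B. y \<le> i}" using that mono[of j u] by (auto simp: U_def)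
    next
      fix y assume "y \<in> {y\<in>?B. y \<le> i}"
      then obtain j where j: "j < ?n" "y = \<beta> ! j" "y \<le> i" by (auto simp: in_set_conv_nth)
      have "f < u" "\<beta> ! f = i" using that f by (auto simp: U_def le_less)
      then have "\<exists>j'<u. y = \<beta> ! j'"
        using j that mono[of u j] by (cases "j < u") (auto simp: U_def)
      then show "y \<in> set (take u \<beta>)" using take that by auto
    qed
    have "(\<Prod>u\<in>U. ?L u) = ?L f * (\<Prod>u\<in>U - {f}. ?L u)"
      using fin f by (simp add: prod.remove)
    also have "?L f = row_exc t ?B i"
      using f by (simp add: drop take_f row_exc_def)
    also have "(\<Prod>u\<in>U - {f}. ?L u) = (\<Prod>u\<in>U - {f}. row_both t ?B i)"
      by (intro prod.cong) (simp_all add: drop take_U row_both_def)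
    also have "\<dots> = row_both t ?B i ^ (card U - 1)"
      using fin f by simp
    finally show "(\<Prod>u\<in>{u\<in>{..<?n}. \<beta> ! u = i}. ?L u) = block_poly (row_both t ?B i) (row_exc t ?B i) (count (mset \<beta>) i)"
      unfolding U_def[symmetric] card[symmetric]
      using \<open>U \<noteq> {}\<close> fin by (simp add: block_poly_def mult.commute)
  qed
  finally show ?thesis by (simp add: vars_def)
qed

section \<open>Codes\<close>

text \<open>The weight of all markings of a letter with \<open>c\<close> occurrences. It vanishes
  for \<open>c \<le> 1\<close>, which enforces at least two occurrences.\<close>

definition mark_sum :: "'a::comm_semiring_1 \<Rightarrow> nat \<Rightarrow> 'a" where
  "mark_sum t c = (\<Sum>f\<in>{1..c - 1}. t ^ f)"

lemma mark_sum_geometric: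
  fixes t :: "'a::comm_ring_1"
  assumes "c > 0"
  shows "(1 - t) * mark_sum t c = t - t ^ c"
proof -
  obtain d where c: "c = Suc d" using assms by (cases c) auto
  have "(1 - t) * (\<Sum>f\<in>{1..d}. t ^ f) = t - t ^ Suc d"
  proof (induction d)
    case (Suc d)
    have "(1 - t) * (\<Sum>f\<in>{1..Suc d}. t ^ f) = (1 - t) * (\<Sum>f\<in>{1..d}. t ^ f) + (1 - t) * t ^ Suc d"
      by (simp add: distrib_left)
    also have "\<dots> = t - t ^ Suc (Suc d)" unfolding Suc.IH by (simp add: algebra_simps)
    finally show ?case .
  qed simp
  then show ?thesis by (simp add: mark_sum_def c)
qed

text \<open>\<kappa> collects the blocks of the positions that hold the letter \<open>Suc m\<close>;
  the positions left at the end hold the letter 0, which carries no mark.\<close>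

primrec code_sum :: "'a::comm_semiring_1 \<Rightarrow> nat \<Rightarrow> 'b multiset \<Rightarrow> 'a" where
  "code_sum t 0 \<mu> = 1"
| "code_sum t (Suc m) \<mu> = (\<Sum>\<kappa>\<in>{\<kappa>. \<kappa> \<subseteq># \<mu>}. mark_sum t (size \<kappa>) * code_sum t m (\<mu> - \<kappa>))"

text \<open>Removing the largest letter gives a recurrence with coefficients
  \<open>mark_sum\<close>; multiplied by \<open>1 - t\<close> it becomes
  \<open>exc_coeff_recurrence\<close>, and \<open>t \<noteq> 1\<close> permits cancelling. A removed
  letter of non-zero weight occurs at least twice, so the bound on the size survives the step from
  \<open>Suc K\<close> to \<open>K\<close>.\<close>

lemma sum_code_sum:
  fixes t :: "'a::idom"
  assumes "t \<noteq> 1" "finite B" "set_mset \<mu> \<subseteq> B" "size \<mu> \<le> K"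
  shows "(\<Sum>m\<le>K. code_sum t m \<mu>) = exc_coeff t B \<mu>"
  using assms(3,4)
proof (induction K arbitrary: \<mu>)
  case 0
  then show ?case by (simp add: exc_coeff_empty)
next
  case (Suc K)
  let ?S = "{\<kappa>. \<kappa> \<subseteq># \<mu>}" and ?N = "exc_coeff t B"
  have "(\<Sum>m\<le>Suc K. code_sum t m \<mu>)
      = 1 + (\<Sum>m\<le>K. \<Sum>\<kappa>\<in>?S. mark_sum t (size \<kappa>) * code_sum t m (\<mu> - \<kappa>))"
    by (subst sum.atMost_Suc_shift) simp
  also have "(\<Sum>m\<le>K. \<Sum>\<kappa>\<in>?S. mark_sum t (size \<kappa>) * code_sum t m (\<mu> - \<kappa>))
      = (\<Sum>\<kappa>\<in>?S. mark_sum t (size \<kappa>) * (\<Sum>m\<le>K. code_sum t m (\<mu> - \<kappa>)))"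
    by (subst sum.swap) (simp add: sum_distrib_left)
  also have "\<dots> = (\<Sum>\<kappa>\<in>?S. mark_sum t (size \<kappa>) * ?N (\<mu> - \<kappa>))"
  proof (rule sum.cong[OF refl])
    fix \<kappa> assume \<kappa>: "\<kappa> \<in> ?S"
    show "mark_sum t (size \<kappa>) * (\<Sum>m\<le>K. code_sum t m (\<mu> - \<kappa>)) = mark_sum t (size \<kappa>) * ?N (\<mu> - \<kappa>)"
    proof (cases "size \<kappa> \<le> 1")
      case True
      then show ?thesis by (simp add: mark_sum_def)
    next
      case False
      then have "size (\<mu> - \<kappa>) \<le> K" using \<kappa> Suc.prems(2) by (simp add: size_Diff_submset)
      moreover have "set_mset (\<mu> - \<kappa>) \<subseteq> B" using Suc.prems(1) by (auto dest: in_diffD)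
      ultimately show ?thesis using Suc.IH by simp
    qed
  qed
  finally have "(1 - t) * (\<Sum>m\<le>Suc K. code_sum t m \<mu>)
      = (1 - t) + (\<Sum>\<kappa>\<in>?S. (1 - t) * mark_sum t (size \<kappa>) * ?N (\<mu> - \<kappa>))"
    by (simp add: distrib_left sum_distrib_left mult.assoc)
  \<comment> \<open>The empty \<kappa> has to be left out: \<open>mark_sum t 0\<close> is 0, whereas
    \<open>t - t ^ 0\<close> is not.\<close>
  also have "(\<Sum>\<kappa>\<in>?S. (1 - t) * mark_sum t (size \<kappa>) * ?N (\<mu> - \<kappa>))
      = (\<Sum>\<kappa>\<in>?S - {{#}}. (t - t ^ size \<kappa>) * ?N (\<mu> - \<kappa>))"
  proof (rule sum.mono_neutral_cong_right)
    fix \<kappa> assume "\<kappa> \<in> ?S - {{#}}"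
    then have "size \<kappa> > 0" by (simp add: nonempty_has_size[symmetric])
    then show "(1 - t) * mark_sum t (size \<kappa>) * ?N (\<mu> - \<kappa>) = (t - t ^ size \<kappa>) * ?N (\<mu> - \<kappa>)"
      by (simp add: mark_sum_geometric)
  qed (auto simp: mark_sum_def)
  also have "\<dots> = - (\<Sum>\<kappa>\<in>?S - {{#}}. (t ^ size \<kappa> - t) * ?N (\<mu> - \<kappa>))"
    by (simp add: sum_negf[symmetric] algebra_simps)
  also have "(\<Sum>\<kappa>\<in>?S - {{#}}. (t ^ size \<kappa> - t) * ?N (\<mu> - \<kappa>)) = (1 - t) - (1 - t) * ?N \<mu>"
    using exc_coeff_recurrence[OF assms(2) Suc.prems(1), of t]
    by (simp add: sum.remove[of ?S "{#}"] eq_diff_eq add.commute)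
  finally have "(1 - t) * (\<Sum>m\<le>Suc K. code_sum t m \<mu>) = (1 - t) * ?N \<mu>" by simp
  then show ?case using assms(1) by simp
qed

section \<open>Words as multisets of pairs of a block and a letter\<close>

definition biwords :: "'b multiset \<Rightarrow> nat \<Rightarrow> ('b \<times> nat) multiset set" where
  "biwords \<mu> m = {P. image_mset fst P = \<mu> \<and> snd ` set_mset P \<subseteq> {..m}}"

lemma finite_biwords: "finite (biwords \<mu> m)"
proof (rule finite_surj)
  show "finite {xs. set xs \<subseteq> set_mset \<mu> \<times> {..m} \<and> length xs = size \<mu>}"
    by (rule finite_lists_length_eq) simp
  show "biwords \<mu> m \<subseteq> mset ` {xs. set xs \<subseteq> set_mset \<mu> \<times> {..m} \<and> length xs = size \<mu>}"
  proof
    fix P assume P: "P \<in> biwords \<mu> m"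
    obtain xs where xs: "mset xs = P" using ex_mset by blast
    then show "P \<in> mset ` {xs. set xs \<subseteq> set_mset \<mu> \<times> {..m} \<and> length xs = size \<mu>}"
      using P by (intro image_eqI[where x = xs]) (force simp: biwords_def)+
  qed
qed

text \<open>The blocks of the pairs with letter \<open>Suc m\<close> form the \<kappa> in the
  recursion of \<open>code_sum\<close>.\<close>

lemma sum_biwords:
  "(\<Sum>P\<in>biwords \<mu> m. \<Prod>k\<in>{1..m}. mark_sum t (count (image_mset snd P) k)) = code_sum t m \<mu>"
proof (induction m arbitrary: \<mu>)
  case 0
  have "biwords \<mu> 0 = {image_mset (\<lambda>b. (b, 0)) \<mu>}"
  proof (intro equalityI subsetI)
    fix P assume P: "P \<in> biwords \<mu> 0"
    then have "P = image_mset (\<lambda>z. (fst z, 0)) P"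
      by (intro multiset.map_ident_strong[symmetric]) (auto simp: biwords_def prod_eq_iff)
    also have "\<dots> = image_mset (\<lambda>b. (b, 0)) (image_mset fst P)"
      by (simp add: image_mset.compositionality comp_def)
    finally show "P \<in> {image_mset (\<lambda>b. (b, 0)) \<mu>}" using P by (simp add: biwords_def)
  qed (auto simp: biwords_def image_mset.compositionality comp_def)
  then show ?case by simp
next
  case (Suc m)
  let ?S = "{\<kappa>. \<kappa> \<subseteq># \<mu>}"
  let ?join = "\<lambda>(\<kappa>, P). P + image_mset (\<lambda>b. (b, Suc m)) \<kappa>"
  let ?split = "\<lambda>P. (image_mset fst (filter_mset (\<lambda>z. snd z = Suc m) P), filter_mset (\<lambda>z. snd z \<noteq> Suc m) P)"
  have "code_sum t (Suc m) \<mu>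
     = (\<Sum>\<kappa>\<in>?S. \<Sum>P\<in>biwords (\<mu> - \<kappa>) m. mark_sum t (size \<kappa>) * (\<Prod>k\<in>{1..m}. mark_sum t (count (image_mset snd P) k)))"
    by (simp add: Suc.IH[symmetric] sum_distrib_left)
  also have "\<dots> = (\<Sum>(\<kappa>, P)\<in>(SIGMA \<kappa>:?S. biwords (\<mu> - \<kappa>) m).
      mark_sum t (size \<kappa>) * (\<Prod>k\<in>{1..m}. mark_sum t (count (image_mset snd P) k)))"
    by (rule sum.Sigma) (simp_all add: finite_biwords)
  also have "\<dots> = (\<Sum>P\<in>biwords \<mu> (Suc m). \<Prod>k\<in>{1..Suc m}. mark_sum t (count (image_mset snd P) k))"
  proof (rule sum.reindex_bij_witness[where i = ?split and j = ?join])
    fix x assume "x \<in> (SIGMA \<kappa>:?S. biwords (\<mu> - \<kappa>) m)"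
    then obtain \<kappa> P where x: "x = (\<kappa>, P)" "\<kappa> \<subseteq># \<mu>" "P \<in> biwords (\<mu> - \<kappa>) m" by auto
    have ne: "snd z \<noteq> Suc m" if "z \<in># P" for z using x(3) that by (force simp: biwords_def)
    have "filter_mset (\<lambda>z. snd z = Suc m) P = filter_mset (\<lambda>z. False) P"
      "filter_mset (\<lambda>z. snd z \<noteq> Suc m) P = filter_mset (\<lambda>z. True) P"
      by (rule filter_mset_cong; use ne in simp)+
    then have P: "filter_mset (\<lambda>z. snd z = Suc m) P = {#}" "filter_mset (\<lambda>z. snd z \<noteq> Suc m) P = P"
      by simp_all
    show "?split (?join x) = x"
      by (simp add: x P filter_mset_image_mset image_mset.compositionality comp_def)
    show "?join x \<in> biwords \<mu> (Suc m)"
      using x by (auto simp: biwords_def image_mset.compositionality comp_def)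
    have cnt: "count (image_mset snd (?join x)) k = count (image_mset snd P) k + (if k = Suc m then size \<kappa> else 0)" for k
      by (simp add: x image_mset.compositionality comp_def image_mset_const_eq)
    have "Suc m \<notin># image_mset snd P" using ne by force
    then have "count (image_mset snd P) (Suc m) = 0" by (simp only: not_in_iff)
    then have "(\<Prod>k\<in>{1..Suc m}. mark_sum t (count (image_mset snd (?join x)) k))
       = (\<Prod>k\<in>{1..m}. mark_sum t (count (image_mset snd (?join x)) k)) * mark_sum t (size \<kappa>)"
      by (simp add: cnt)
    also have "(\<Prod>k\<in>{1..m}. mark_sum t (count (image_mset snd (?join x)) k)) = (\<Prod>k\<in>{1..m}. mark_sum t (count (image_mset snd P) k))"
      by (intro prod.cong) (simp_all only: cnt, simp)
    finally show "(\<Prod>k\<in>{1..Suc m}. mark_sum t (count (image_mset snd (?join x)) k))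
      = (case x of (\<kappa>, P) \<Rightarrow> mark_sum t (size \<kappa>) * (\<Prod>k\<in>{1..m}. mark_sum t (count (image_mset snd P) k)))"
      by (simp add: x mult.commute)
  next
    fix P assume P: "P \<in> biwords \<mu> (Suc m)"
    have "image_mset (\<lambda>b. (b, Suc m)) (image_mset fst (filter_mset (\<lambda>z. snd z = Suc m) P))
        = filter_mset (\<lambda>z. snd z = Suc m) P"
      unfolding image_mset.compositionality comp_def
      by (intro multiset.map_ident_strong) (auto simp: prod_eq_iff)
    then show "?join (?split P) = P" by (simp add: add.commute flip: multiset_partition)
    have part: "\<mu> = image_mset fst (filter_mset (\<lambda>z. snd z = Suc m) P) + image_mset fst (filter_mset (\<lambda>z. snd z \<noteq> Suc m) P)"
      using P by (simp add: biwords_def flip: image_mset_union multiset_partition)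
    have "snd ` set_mset (filter_mset (\<lambda>z. snd z \<noteq> Suc m) P) \<subseteq> {..m}"
      using P by (fastforce simp: biwords_def)
    then show "?split P \<in> (SIGMA \<kappa>:?S. biwords (\<mu> - \<kappa>) m)"
      using part by (auto simp: biwords_def)
  qed
  finally show ?case ..
qed

definition blockwise_sorted_words :: "nat list \<Rightarrow> nat \<Rightarrow> nat list set" where
  "blockwise_sorted_words \<beta> m = {\<alpha>. set \<alpha> \<subseteq> {..m} \<and> length \<alpha> = length \<beta> \<and>
     (\<forall>i. Suc i < length \<beta> \<longrightarrow> \<beta> ! i = \<beta> ! Suc i \<longrightarrow> \<alpha> ! i \<le> \<alpha> ! Suc i)}"

text \<open>A word that increases weakly within the blocks is determined by its pairs (block,
  letter): their lexicographic order restores \<beta> in the first components and the word in the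
  second.\<close>

lemma sum_blockwise_sorted_words:
  assumes "sorted \<beta>"
  shows "(\<Sum>\<alpha>\<in>blockwise_sorted_words \<beta> m. F (mset \<alpha>)) = (\<Sum>P\<in>biwords (mset \<beta>) m. F (image_mset snd P))"
proof (rule sum.reindex_bij_witness[where i = "\<lambda>P. map snd (sorted_list_of_multiset P)" and j = "\<lambda>\<alpha>. mset (zip \<beta> \<alpha>)"])
  fix \<alpha> assume \<alpha>: "\<alpha> \<in> blockwise_sorted_words \<beta> m"
  then have len: "length \<alpha> = length \<beta>" by (simp add: blockwise_sorted_words_def)
  have "sorted (zip \<beta> \<alpha>)"
    using assms \<alpha> unfolding sorted_iff_nth_Suc
    by (auto simp: blockwise_sorted_words_def less_eq_prod_def order_less_le)
  then show "map snd (sorted_list_of_multiset (mset (zip \<beta> \<alpha>))) = \<alpha>"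
    using len by (simp add: sorted_sort_id)
  show "mset (zip \<beta> \<alpha>) \<in> biwords (mset \<beta>) m"
    using \<alpha> len by (auto simp: biwords_def blockwise_sorted_words_def simp flip: mset_map dest: set_zip_rightD)
  show "F (image_mset snd (mset (zip \<beta> \<alpha>))) = F (mset \<alpha>)"
    using len by (simp flip: mset_map)
next
  fix P assume P: "P \<in> biwords (mset \<beta>) m"
  define l where "l = sorted_list_of_multiset P"
  have l: "sorted l" "mset l = P" by (auto simp: l_def)
  have "mset (map fst l) = mset \<beta>" using P l by (simp add: biwords_def)
  moreover have "sorted (map fst l)"
    using l(1) unfolding sorted_iff_nth_Suc by (auto simp: less_eq_prod_def)
  ultimately have fst_l: "map fst l = \<beta>" using assms by (metis properties_for_sort)
  then have len: "length l = length \<beta>" by (metis length_map)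
  show "mset (zip \<beta> (map snd (sorted_list_of_multiset P))) = P"
    using l fst_l by (simp add: l_def[symmetric] zip_map_fst_snd flip: fst_l)
  have "map snd l ! i \<le> map snd l ! Suc i" if "Suc i < length \<beta>" "\<beta> ! i = \<beta> ! Suc i" for i
  proof -
    have "fst (l ! i) = fst (l ! Suc i)"
      using that len nth_map[of i l fst] nth_map[of "Suc i" l fst] by (simp add: fst_l)
    then show ?thesis
      using sorted_nth_mono[OF l(1), of i "Suc i"] that len by (simp add: less_eq_prod_def)
  qed
  moreover have "set (map snd l) \<subseteq> {..m}"
    using P by (simp add: biwords_def flip: l(2))
  ultimately show "map snd (sorted_list_of_multiset P) \<in> blockwise_sorted_words \<beta> m"
    using len by (simp add: blockwise_sorted_words_def l_def)
qed

text \<open>The sum of \<open>t\<close> to the power \<open>\<Sum>k. f k\<close> over all markings \<open>f\<close> of a word with content \<open>M\<close>. It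
  vanishes unless each of the letters \<open>1, \<dots>, max M\<close> occurs at least twice.\<close>

definition code_weight :: "'a::comm_semiring_1 \<Rightarrow> nat multiset \<Rightarrow> 'a" where
  "code_weight t M = (\<Prod>k\<in>{1..Max (insert 0 (set_mset M))}. mark_sum t (count M k))"

text \<open>Only the maximum contributes: a smaller \<open>m\<close> violates the inclusion, and for
  a larger one the letter \<open>m\<close> is absent, so its factor is 0. The range of the product
  no longer depends on \<open>M\<close>, which allows exchanging sums.\<close>

lemma code_weight_eq_sum:
  assumes "set_mset M \<subseteq> {..K}"
  shows "code_weight t M = (\<Sum>m\<le>K. if set_mset M \<subseteq> {..m} then \<Prod>k\<in>{1..m}. mark_sum t (count M k) else 0)"
proof -
  define x where "x = Max (insert 0 (set_mset M))"
  have le: "y \<le> x" if "y \<in># M" for y unfolding x_def using that by (intro Max_ge) auto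
  have "x \<in> insert 0 (set_mset M)" unfolding x_def by (rule Max_in) auto
  then have x: "x = 0 \<or> x \<in># M" by auto
  then have "x \<le> K" using assms by auto
  have "(\<Sum>m\<le>K. if set_mset M \<subseteq> {..m} then \<Prod>k\<in>{1..m}. mark_sum t (count M k) else 0)
     = (\<Sum>m\<in>{x}. if set_mset M \<subseteq> {..m} then \<Prod>k\<in>{1..m}. mark_sum t (count M k) else 0)"
  proof (rule sum.mono_neutral_right)
    show "\<forall>m\<in>{..K} - {x}. (if set_mset M \<subseteq> {..m} then \<Prod>k\<in>{1..m}. mark_sum t (count M k) else 0) = 0"
    proof
      fix m assume "m \<in> {..K} - {x}"
      show "(if set_mset M \<subseteq> {..m} then \<Prod>k\<in>{1..m}. mark_sum t (count M k) else 0) = 0"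
      proof (cases "m < x")
        case True
        then show ?thesis using x by auto
      next
        case False
        then have "m > x" using \<open>m \<in> {..K} - {x}\<close> by auto
        then have "m \<notin># M" using le by force
        then have "mark_sum t (count M m) = 0" by (simp add: mark_sum_def not_in_iff)
        then have "(\<Prod>k\<in>{1..m}. mark_sum t (count M k)) = 0"
          using \<open>m > x\<close> by (intro prod_zero) auto
        then show ?thesis by simp
      qed
    qed
  qed (use \<open>x \<le> K\<close> in auto)
  also have "\<dots> = code_weight t M"
    using le by (auto simp: code_weight_def x_def[symmetric])
  finally show ?thesis ..
qed

lemma sum_blockwise_code_weight:
  fixes t :: "'a::idom"
  assumes "sorted \<beta>" "length \<beta> \<le> K" "t \<noteq> 1"
  shows "(\<Sum>\<alpha>\<in>blockwise_sorted_words \<beta> K. code_weight t (mset \<alpha>)) = (\<Sum>w\<in>blockwise_dex_perms \<beta>. t ^ exc w)"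
proof -
  have fin: "finite (blockwise_sorted_words \<beta> K)"
    by (rule finite_subset[OF _ finite_lists_length_eq[of "{..K}" "length \<beta>"]])
      (auto simp: blockwise_sorted_words_def)
  have "(\<Sum>\<alpha>\<in>blockwise_sorted_words \<beta> K. code_weight t (mset \<alpha>))
     = (\<Sum>\<alpha>\<in>blockwise_sorted_words \<beta> K. \<Sum>m\<le>K. if set \<alpha> \<subseteq> {..m} then \<Prod>k\<in>{1..m}. mark_sum t (count (mset \<alpha>) k) else 0)"
  proof (rule sum.cong[OF refl])
    fix \<alpha> assume "\<alpha> \<in> blockwise_sorted_words \<beta> K"
    then have "set_mset (mset \<alpha>) \<subseteq> {..K}" by (simp add: blockwise_sorted_words_def)
    from code_weight_eq_sum[OF this, of t]
    show "code_weight t (mset \<alpha>) = (\<Sum>m\<le>K. if set \<alpha> \<subseteq> {..m} then \<Prod>k\<in>{1..m}. mark_sum t (count (mset \<alpha>) k) else 0)"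
      by (simp only: set_mset_mset)
  qed
  also have "\<dots> = (\<Sum>m\<le>K. \<Sum>\<alpha>\<in>blockwise_sorted_words \<beta> K. if set \<alpha> \<subseteq> {..m} then \<Prod>k\<in>{1..m}. mark_sum t (count (mset \<alpha>) k) else 0)"
    by (rule sum.swap)
  also have "\<dots> = (\<Sum>m\<le>K. \<Sum>\<alpha>\<in>blockwise_sorted_words \<beta> m. \<Prod>k\<in>{1..m}. mark_sum t (count (mset \<alpha>) k))"
  proof (rule sum.cong[OF refl])
    fix m assume "m \<in> {..K}"
    then have "blockwise_sorted_words \<beta> m = {\<alpha> \<in> blockwise_sorted_words \<beta> K. set \<alpha> \<subseteq> {..m}}"
      by (auto simp: blockwise_sorted_words_def)
    then show "(\<Sum>\<alpha>\<in>blockwise_sorted_words \<beta> K. if set \<alpha> \<subseteq> {..m} then \<Prod>k\<in>{1..m}. mark_sum t (count (mset \<alpha>) k) else 0)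
      = (\<Sum>\<alpha>\<in>blockwise_sorted_words \<beta> m. \<Prod>k\<in>{1..m}. mark_sum t (count (mset \<alpha>) k))"
      using fin by (simp only: sum.inter_filter)
  qed
  also have "\<dots> = (\<Sum>m\<le>K. code_sum t m (mset \<beta>))"
    by (intro sum.cong refl, subst sum_biwords[symmetric]) (rule sum_blockwise_sorted_words[OF assms(1)])
  also have "\<dots> = exc_coeff t (set \<beta>) (mset \<beta>)"
    using assms by (intro sum_code_sum) auto
  also have "\<dots> = (\<Sum>w\<in>blockwise_dex_perms \<beta>. t ^ exc w)"
    unfolding sum_blockwise_dex_perms_coeff[OF assms(1)] prod_rows_sorted[OF assms(1)] exc_coeff_def ..
  finally show ?thesis .
qed

section \<open>Blocks cut out by a set of positions\<close>

definition block_index :: "nat \<Rightarrow> nat set \<Rightarrow> nat list" where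
  "block_index n T = map (\<lambda>i. card {j\<in>T. j \<le> i}) [0..<n]"

lemma length_block_index [simp]: "length (block_index n T) = n"
  by (simp add: block_index_def)

text \<open>Descents are numbered from 1 and list positions from 0, so an element
  \<open>Suc i\<close> of \<open>T\<close> is a cut between the list positions \<open>i\<close> and
  \<open>Suc i\<close>.\<close>

lemma block_index_step:
  assumes "finite T" "Suc i < n"
  shows "block_index n T ! Suc i = block_index n T ! i + of_bool (Suc i \<in> T)"
proof -
  have "{j\<in>T. j \<le> Suc i} = (if Suc i \<in> T then insert (Suc i) {j\<in>T. j \<le> i} else {j\<in>T. j \<le> i})"
    by (auto simp: le_Suc_eq)
  then show ?thesis using assms by (auto simp: block_index_def)
qed

lemma sorted_block_index: "finite T \<Longrightarrow> sorted (block_index n T)"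
  by (auto simp: sorted_iff_nth_Suc block_index_step)

text \<open>\<open>DEX\<close> and \<open>DES\<close> both consist of the places where a relation
  \<open>R\<close> between neighbours fails; this translates inclusion in \<open>T\<close> into the
  blockwise conditions for both.\<close>

lemma all_Suc_block_index:
  assumes "T \<subseteq> {1..<n}"
  shows "{i. 1 \<le> i \<and> i < n \<and> \<not> R (i - 1) i} \<subseteq> T
    \<longleftrightarrow> (\<forall>i. Suc i < n \<longrightarrow> block_index n T ! i = block_index n T ! Suc i \<longrightarrow> R i (Suc i))"
proof -
  have "finite T" using assms by (rule finite_subset) simp
  then have eq: "block_index n T ! i = block_index n T ! Suc i \<longleftrightarrow> Suc i \<notin> T" if "Suc i < n" for i
    using that by (simp add: block_index_step)
  show ?thesis
  proof safe
    fix i assume "{i. 1 \<le> i \<and> i < n \<and> \<not> R (i - 1) i} \<subseteq> T" "Suc i < n"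
      "block_index n T ! i = block_index n T ! Suc i"
    then show "R i (Suc i)" using eq[of i] by force
  next
    fix i assume *: "\<forall>i. Suc i < n \<longrightarrow> block_index n T ! i = block_index n T ! Suc i \<longrightarrow> R i (Suc i)"
      and i: "1 \<le> i" "i < n" "\<not> R (i - 1) i"
    then obtain j where "i = Suc j" by (cases i) auto
    then show "i \<in> T" using * i eq[of j] by auto
  qed
qed

lemma eulerian_A_eq_sum_words:
  assumes "n \<le> K"
  shows "eulerian_A n = (\<Sum>\<alpha>\<in>{\<alpha>. set \<alpha> \<subseteq> {..K} \<and> length \<alpha> = n}. code_weight tv (mset \<alpha>) * qv ^ maj \<alpha>)"
proof -
  let ?P = "permutations_of_set {1..n}" and ?W = "{\<alpha>. set \<alpha> \<subseteq> {..K} \<and> length \<alpha> = n}"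
  let ?I = "{1..<n}"
  have len: "length w = n" if "w \<in> ?P" for w
    using length_finite_permutations_of_set[OF that] by simp
  have "eulerian_A n = (\<Sum>w\<in>?P. tv ^ exc w * qv ^ (\<Sum>i\<in>DEX w. i))"
    unfolding eulerian_A_def by (intro sum.cong) (simp_all add: sum_DEX mult.commute)
  also have "\<dots> = (\<Sum>T\<in>Pow ?I. (\<Prod>i\<in>T. qv ^ i) * (\<Prod>i\<in>?I - T. 1 - qv ^ i) *
      (\<Sum>w\<in>{w\<in>?P. DEX w \<subseteq> T}. tv ^ exc w))"
    by (rule sum_power_sum_eq) (auto simp: DEX_def len)
  also have "\<dots> = (\<Sum>T\<in>Pow ?I. (\<Prod>i\<in>T. qv ^ i) * (\<Prod>i\<in>?I - T. 1 - qv ^ i) *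
      (\<Sum>\<alpha>\<in>{\<alpha>\<in>?W. DES \<alpha> \<subseteq> T}. code_weight tv (mset \<alpha>)))"
  proof (rule sum.cong[OF refl])
    fix T assume "T \<in> Pow ?I"
    then have T: "T \<subseteq> ?I" and fin: "finite T" using finite_subset by auto
    have "DEX w \<subseteq> T \<longleftrightarrow> (\<forall>i. Suc i < n \<longrightarrow> block_index n T ! i = block_index n T ! Suc i \<longrightarrow>
        dex_key w i \<le> dex_key w (Suc i))" if "length w = n" for w
      using all_Suc_block_index[OF T, of "\<lambda>i j. dex_key w i \<le> dex_key w j"] that
      by (simp add: DEX_def not_le)
    then have dex: "{w\<in>?P. DEX w \<subseteq> T} = blockwise_dex_perms (block_index n T)"
      using len by (auto simp: blockwise_dex_perms_def)
    have "DES \<alpha> \<subseteq> T \<longleftrightarrow> (\<forall>i. Suc i < n \<longrightarrow> block_index n T ! i = block_index n T ! Suc i \<longrightarrow>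
        \<alpha> ! i \<le> \<alpha> ! Suc i)" if "length \<alpha> = n" for \<alpha> :: "nat list"
      using all_Suc_block_index[OF T, of "\<lambda>i j. \<alpha> ! i \<le> \<alpha> ! j"] that
      by (simp add: DES_def not_le)
    then have des: "{\<alpha>\<in>?W. DES \<alpha> \<subseteq> T} = blockwise_sorted_words (block_index n T) K"
      by (auto simp: blockwise_sorted_words_def)
    \<comment> \<open>\<open>sum_blockwise_code_weight\<close> cancels \<open>1 - t\<close>; here
      \<open>tv\<close> and 1 differ in their constant terms.\<close>
    have "poly tv 0 \<noteq> poly 1 0" by (simp add: tv_def)
    then have "tv \<noteq> 1" by metis
    then have "(\<Sum>w\<in>{w\<in>?P. DEX w \<subseteq> T}. tv ^ exc w) = (\<Sum>\<alpha>\<in>{\<alpha>\<in>?W. DES \<alpha> \<subseteq> T}. code_weight tv (mset \<alpha>))"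
      unfolding dex des
      by (intro sum_blockwise_code_weight[symmetric] sorted_block_index fin) (simp_all add: assms)
    then show "(\<Prod>i\<in>T. qv ^ i) * (\<Prod>i\<in>?I - T. 1 - qv ^ i) * (\<Sum>w\<in>{w\<in>?P. DEX w \<subseteq> T}. tv ^ exc w)
      = (\<Prod>i\<in>T. qv ^ i) * (\<Prod>i\<in>?I - T. 1 - qv ^ i) * (\<Sum>\<alpha>\<in>{\<alpha>\<in>?W. DES \<alpha> \<subseteq> T}. code_weight tv (mset \<alpha>))"
      by simp
  qed
  also have "\<dots> = (\<Sum>\<alpha>\<in>?W. code_weight tv (mset \<alpha>) * qv ^ (\<Sum>i\<in>DES \<alpha>. i))"
    by (rule sum_power_sum_eq[symmetric]) (auto simp: DES_def finite_lists_length_eq)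
  finally show ?thesis by (simp add: maj_def)
qed

section \<open>Extended codes\<close>

definition msets_of_size :: "'a set \<Rightarrow> nat \<Rightarrow> 'a multiset set" where
  "msets_of_size A n = {M. set_mset M \<subseteq> A \<and> size M = n}"

lemma finite_msets_of_size:
  assumes "finite A"
  shows "finite (msets_of_size A n)"
proof (rule finite_surj)
  show "finite {xs. set xs \<subseteq> A \<and> length xs = n}" using assms by (rule finite_lists_length_eq)
  show "msets_of_size A n \<subseteq> mset ` {xs. set xs \<subseteq> A \<and> length xs = n}"
  proof
    fix M assume M: "M \<in> msets_of_size A n"
    obtain xs where "mset xs = M" using ex_mset by blast
    then show "M \<in> mset ` {xs. set xs \<subseteq> A \<and> length xs = n}"
      using M by (intro image_eqI[where x = xs]) (auto simp: msets_of_size_def)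
  qed
qed

lemma sum_words_by_content:
  fixes F :: "'a multiset \<Rightarrow> 'b::comm_semiring_0"
  assumes "finite A"
  shows "(\<Sum>\<alpha>\<in>{\<alpha>. set \<alpha> \<subseteq> A \<and> length \<alpha> = n}. F (mset \<alpha>) * g \<alpha>)
    = (\<Sum>M\<in>msets_of_size A n. F M * (\<Sum>w\<in>permutations_of_multiset M. g w))"
proof -
  let ?W = "{\<alpha>. set \<alpha> \<subseteq> A \<and> length \<alpha> = n}"
  have "(\<Sum>\<alpha>\<in>?W. F (mset \<alpha>) * g \<alpha>)
     = (\<Sum>M\<in>msets_of_size A n. \<Sum>\<alpha>\<in>{\<alpha>\<in>?W. mset \<alpha> = M}. F (mset \<alpha>) * g \<alpha>)"
    using assms
    by (intro sum.group[symmetric] finite_lists_length_eq finite_msets_of_size) (auto simp: msets_of_size_def)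
  also have "\<dots> = (\<Sum>M\<in>msets_of_size A n. F M * (\<Sum>w\<in>permutations_of_multiset M. g w))"
  proof (rule sum.cong[OF refl])
    fix M assume "M \<in> msets_of_size A n"
    then have "{\<alpha>\<in>?W. mset \<alpha> = M} = permutations_of_multiset M"
      by (auto simp: msets_of_size_def permutations_of_multiset_def)
    then show "(\<Sum>\<alpha>\<in>{\<alpha>\<in>?W. mset \<alpha> = M}. F (mset \<alpha>) * g \<alpha>) = F M * (\<Sum>w\<in>permutations_of_multiset M. g w)"
      by (simp add: sum_distrib_left permutations_of_multiset_def)
  qed
  finally show ?thesis .
qed

section \<open>Adjoining copies of the letter infinity to a content\<close>

definition with_infty :: "nat multiset \<Rightarrow> nat \<Rightarrow> enat multiset" where
  "with_infty M j = image_mset enat M + replicate_mset j \<infinity>"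

definition finite_part :: "enat multiset \<Rightarrow> nat multiset" where
  "finite_part M = image_mset the_enat (filter_mset (\<lambda>x. x \<noteq> \<infinity>) M)"

lemma finite_part_with_infty [simp]: "finite_part (with_infty M j) = M"
  by (simp add: finite_part_def with_infty_def filter_mset_image_mset image_mset.compositionality comp_def)

lemma with_infty_finite_part: "with_infty (finite_part M) (count M \<infinity>) = M"
proof -
  have "image_mset enat (finite_part M) = filter_mset (\<lambda>x. x \<noteq> \<infinity>) M"
    unfolding finite_part_def image_mset.compositionality comp_def
    by (intro multiset.map_ident_strong) (auto simp: not_infinity_eq)
  moreover have "filter_mset (\<lambda>x. x = \<infinity>) M = replicate_mset (count M \<infinity>) \<infinity>"
    by (rule filter_eq_replicate_mset)
  ultimately show ?thesis
    by (metis multiset_partition with_infty_def add.commute)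
qed

lemma count_with_infty [simp]: "count (with_infty M j) (enat k) = count M k"
proof -
  have "count (image_mset enat M) (enat k) = count M k" by (induction M) auto
  then show ?thesis by (simp add: with_infty_def)
qed

lemma count_finite_part: "count (finite_part M) k = count M (enat k)"
  using count_with_infty[of "finite_part M" "count M \<infinity>" k] by (simp add: with_infty_finite_part)

lemma q_mset_fact_with_infty: "q_mset_fact (with_infty M j) = q_mset_fact M * q_fact j"
proof -
  have "q_mset_fact (with_infty M j) = (\<Prod>x\<in>insert \<infinity> (enat ` set_mset M). q_fact (count (with_infty M j) x))"
    by (rule q_mset_fact_superset) (auto simp: with_infty_def)
  also have "\<dots> = q_fact (count (with_infty M j) \<infinity>) * (\<Prod>k\<in>set_mset M. q_fact (count (with_infty M j) (enat k)))"
    by (subst prod.insert) (auto simp: prod.reindex inj_on_def)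
  also have "count (with_infty M j) \<infinity> = j"
    by (simp add: with_infty_def count_image_mset vimage_def)
  finally show ?thesis by (simp add: q_mset_fact_def mult.commute)
qed

text \<open>The q-multinomial coefficient of the enlarged content is \<open>q_binom n k\<close>
  times that of \<open>M\<close>. The right-hand side uses \<open>maj\<close> because
  \<open>eulerian_A_eq_sum_words\<close> does.\<close>

lemma sum_inv_num_with_infty:
  assumes "size M = k" "k \<le> n"
  shows "(\<Sum>w\<in>permutations_of_multiset (with_infty M (n - k)). qv ^ inv_num w)
    = q_binom n k * (\<Sum>w\<in>permutations_of_multiset M. qv ^ maj w)"
proof -
  let ?D = "q_mset_fact (with_infty M (n - k))"
  have "?D * (\<Sum>w\<in>permutations_of_multiset (with_infty M (n - k)). qv ^ inv_num w) = q_fact n"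
    using assms by (simp add: sum_inv_num with_infty_def)
  also have "\<dots> = q_binom n k * (q_fact k * q_fact (n - k))"
    using assms(2) by (simp add: q_binom_mult)
  also have "q_fact k = q_mset_fact M * (\<Sum>w\<in>permutations_of_multiset M. qv ^ maj w)"
    using assms(1) by (simp add: sum_maj)
  finally have "?D * (\<Sum>w\<in>permutations_of_multiset (with_infty M (n - k)). qv ^ inv_num w)
     = ?D * (q_binom n k * (\<Sum>w\<in>permutations_of_multiset M. qv ^ maj w))"
    by (simp add: q_mset_fact_with_infty mult_ac)
  then show ?thesis by (simp add: q_mset_fact_nonzero)
qed

text \<open>The total weight of the markings of one word. Index -1 gives 1 for words with infinite
  letters only; otherwise the shift of the index by 1 gives the factor \<open>tv\<close>.\<close>

definition ext_weight :: "enat multiset \<Rightarrow> int poly poly" where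
  "ext_weight M = (if set_mset M \<subseteq> {\<infinity>} then 1 else tv * code_weight tv (finite_part M))"

lemma sum_ext_codes:
  assumes K: "\<And>\<alpha> f. (\<alpha>, f) \<in> ext_codes n \<Longrightarrow> max_letter \<alpha> \<le> K"
  shows "(\<Sum>(\<alpha>, f)\<in>ext_codes n. g \<alpha> * tv ^ nat (ind \<alpha> f + 1))
    = (\<Sum>\<alpha>\<in>{\<alpha>. set \<alpha> \<subseteq> insert \<infinity> (enat ` {..K}) \<and> length \<alpha> = n}. ext_weight (mset \<alpha>) * g \<alpha>)"
proof -
  let ?W = "{\<alpha>. set \<alpha> \<subseteq> insert \<infinity> (enat ` {..K}) \<and> length \<alpha> = n}"
  let ?F = "\<lambda>\<alpha>. \<Pi>\<^sub>E k\<in>{1..max_letter \<alpha>}. {1..count_list \<alpha> (enat k) - 1}"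
  have finW: "finite ?W" by (rule finite_lists_length_eq) simp
  have letters: "x \<in> insert \<infinity> (enat ` {..max_letter \<alpha>})" if "x \<in> set \<alpha>" for x \<alpha>
  proof (cases x)
    case (enat k)
    then have "k \<le> max_letter \<alpha>"
      unfolding max_letter_def using that finite_letters by (intro Max_ge) auto
    then show ?thesis using enat by auto
  qed simp
  have eq: "ext_codes n = (SIGMA \<alpha>:?W. ?F \<alpha>)"
  proof (intro equalityI subsetI)
    fix x assume x: "x \<in> ext_codes n"
    then obtain \<alpha> f where \<alpha>: "x = (\<alpha>, f)" by (cases x)
    have "set \<alpha> \<subseteq> insert \<infinity> (enat ` {..K})"
      using K[of \<alpha> f] x letters[of _ \<alpha>] unfolding \<alpha> by fastforce
    then show "x \<in> (SIGMA \<alpha>:?W. ?F \<alpha>)" using x by (auto simp: \<alpha> ext_codes_def)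
  next
    fix x assume "x \<in> (SIGMA \<alpha>:?W. ?F \<alpha>)"
    then obtain \<alpha> f where x: "x = (\<alpha>, f)" "\<alpha> \<in> ?W" "f \<in> ?F \<alpha>" by auto
    \<comment> \<open>A value of \<open>f\<close> at \<open>k\<close> exists only if the interval of
      possible marks is non-empty, that is, if \<open>k\<close> occurs at least twice.\<close>
    have "2 \<le> count_list \<alpha> (enat k)" if "k \<in> {1..max_letter \<alpha>}" for k
      using PiE_mem[OF x(3) that] by auto
    then show "x \<in> ext_codes n" using x by (auto simp: ext_codes_def)
  qed
  have weight: "(\<Sum>f\<in>?F \<alpha>. tv ^ nat (ind \<alpha> f + 1)) = ext_weight (mset \<alpha>)" for \<alpha>
  proof (cases "set \<alpha> \<subseteq> {\<infinity>}")
    case True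
    then have "{k. enat k \<in> set \<alpha>} = {}" by auto
    then have "max_letter \<alpha> = 0" by (simp add: max_letter_def)
    then show ?thesis using True by (simp add: ind_def ext_weight_def)
  next
    case False
    have "enat k \<in> set \<alpha> \<longleftrightarrow> k \<in># finite_part (mset \<alpha>)" for k
      unfolding count_greater_zero_iff[symmetric] count_finite_part by simp
    then have "{k. enat k \<in> set \<alpha>} = set_mset (finite_part (mset \<alpha>))" by auto
    then have max: "max_letter \<alpha> = Max (insert 0 (set_mset (finite_part (mset \<alpha>))))"
      by (simp add: max_letter_def)
    have "(\<Sum>f\<in>?F \<alpha>. tv ^ nat (ind \<alpha> f + 1)) = tv * (\<Sum>f\<in>?F \<alpha>. \<Prod>k\<in>{1..max_letter \<alpha>}. tv ^ f k)"
      using False by (simp add: ind_def nat_add_distrib sum_nonneg sum_distrib_left power_sum flip: of_nat_sum)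
    also have "(\<Sum>f\<in>?F \<alpha>. \<Prod>k\<in>{1..max_letter \<alpha>}. tv ^ f k) = (\<Prod>k\<in>{1..max_letter \<alpha>}. mark_sum tv (count_list \<alpha> (enat k)))"
      unfolding mark_sum_def by (rule prod_sum_PiE[symmetric]) auto
    also have "\<dots> = code_weight tv (finite_part (mset \<alpha>))"
      unfolding code_weight_def max[symmetric] by (simp add: count_finite_part count_mset)
    finally show ?thesis using False by (simp add: ext_weight_def)
  qed
  have "(\<Sum>(\<alpha>, f)\<in>ext_codes n. g \<alpha> * tv ^ nat (ind \<alpha> f + 1)) = (\<Sum>\<alpha>\<in>?W. \<Sum>f\<in>?F \<alpha>. g \<alpha> * tv ^ nat (ind \<alpha> f + 1))"
    unfolding eq by (rule sum.Sigma[symmetric]) (use finW in \<open>auto intro!: finite_PiE\<close>)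
  then show ?thesis unfolding sum_distrib_left[symmetric] weight by (simp add: mult.commute)
qed

lemma sum_msets_with_infty:
  "(\<Sum>M\<in>msets_of_size (insert \<infinity> (enat ` A)) n. F M)
    = (\<Sum>k\<le>n. \<Sum>M\<in>msets_of_size A k. F (with_infty M (n - k)))" if "finite A"
proof -
  have "(\<Sum>k\<le>n. \<Sum>M\<in>msets_of_size A k. F (with_infty M (n - k)))
     = (\<Sum>(k, M)\<in>(SIGMA k:{..n}. msets_of_size A k). F (with_infty M (n - k)))"
    using that by (intro sum.Sigma) (simp_all add: finite_msets_of_size)
  also have "\<dots> = (\<Sum>M\<in>msets_of_size (insert \<infinity> (enat ` A)) n. F M)"
  proof (rule sum.reindex_bij_witness[where i = "\<lambda>M. (size (finite_part M), finite_part M)"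
        and j = "\<lambda>(k, M). with_infty M (n - k)"])
    fix M assume M: "M \<in> msets_of_size (insert \<infinity> (enat ` A)) n"
    have "size M = size (finite_part M) + count M \<infinity>"
      by (subst with_infty_finite_part[symmetric]) (simp add: with_infty_def)
    then have sz: "n - size (finite_part M) = count M \<infinity>" "size (finite_part M) \<le> n"
      using M by (auto simp: msets_of_size_def)
    then show "(\<lambda>(k, M). with_infty M (n - k)) (size (finite_part M), finite_part M) = M"
      by (simp add: with_infty_finite_part)
    show "(size (finite_part M), finite_part M) \<in> (SIGMA k:{..n}. msets_of_size A k)"
      using M sz by (auto simp: msets_of_size_def finite_part_def)
  qed (auto simp: msets_of_size_def, auto simp: with_infty_def split: if_splits)
  finally show ?thesis ..
qed

theorem proposition6p15:
  fixes n :: nat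
  shows "binomial_eulerian n
           = (\<Sum>(\<alpha>, f)\<in>ext_codes n. qv ^ inv_num \<alpha> * tv ^ nat (ind \<alpha> f + 1))
       \<and> (\<Sum>(\<alpha>, f)\<in>ext_codes n. qv ^ inv_num \<alpha> * tv ^ nat (ind \<alpha> f + 1))
           = (\<Sum>(\<alpha>, f)\<in>ext_codes n. qv ^ maj \<alpha> * tv ^ nat (ind \<alpha> f + 1))"
proof -
  \<comment> \<open>\<open>K\<close> has to bound the letters of all codes, for
    \<open>sum_ext_codes\<close>, and also \<open>n\<close>, for
    \<open>eulerian_A_eq_sum_words\<close>.\<close>
  define K where "K = Max (insert n ((\<lambda>(\<alpha>, f). max_letter \<alpha>) ` ext_codes n))"
  have "n \<le> K" unfolding K_def by (intro Max_ge) (auto simp: finite_ext_codes)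
  have K: "max_letter \<alpha> \<le> K" if "(\<alpha>, f) \<in> ext_codes n" for \<alpha> f
    unfolding K_def using that by (intro Max_ge) (auto simp: finite_ext_codes intro!: image_eqI[where x = "(\<alpha>, f)"])
  let ?M = "msets_of_size (insert \<infinity> (enat ` {..K})) n"
  have by_content: "(\<Sum>(\<alpha>, f)\<in>ext_codes n. qv ^ stat \<alpha> * tv ^ nat (ind \<alpha> f + 1))
    = (\<Sum>M\<in>?M. ext_weight M * (\<Sum>w\<in>permutations_of_multiset M. qv ^ stat w))" for stat :: "enat list \<Rightarrow> nat"
    by (subst sum_ext_codes[OF K]) (auto intro!: sum_words_by_content)
  have "(\<Sum>(\<alpha>, f)\<in>ext_codes n. qv ^ inv_num \<alpha> * tv ^ nat (ind \<alpha> f + 1))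
     = (\<Sum>k\<le>n. \<Sum>M\<in>msets_of_size {..K} k. ext_weight (with_infty M (n - k)) *
          (q_binom n k * (\<Sum>w\<in>permutations_of_multiset M. qv ^ maj w)))"
    unfolding by_content sum_msets_with_infty[OF finite_atMost]
    by (intro sum.cong refl arg_cong2[where f = "(*)"] sum_inv_num_with_infty) (auto simp: msets_of_size_def)
  also have "\<dots> = (\<Sum>k\<le>n. if k = 0 then 1 else tv * (q_binom n k * eulerian_A k))"
  proof (rule sum.cong[OF refl])
    fix k assume k: "k \<in> {..n}"
    show "(\<Sum>M\<in>msets_of_size {..K} k. ext_weight (with_infty M (n - k)) *
          (q_binom n k * (\<Sum>w\<in>permutations_of_multiset M. qv ^ maj w)))
      = (if k = 0 then 1 else tv * (q_binom n k * eulerian_A k))"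
    \<comment> \<open>For \<open>k = 0\<close> all letters are infinite, which yields the summand 1
      of \<open>binomial_eulerian\<close>; every other content carries the factor
      \<open>tv\<close>.\<close>
    proof (cases "k = 0")
      case True
      have "q_binom n 0 = 1"
        using q_binom_mult[of 0 n] q_fact_nonzero[of n] by (simp add: q_fact_def)
      moreover have "msets_of_size {..K} 0 = {{#}}" by (auto simp: msets_of_size_def)
      ultimately show ?thesis using True by (simp add: ext_weight_def with_infty_def)
    next
      case False
      have "ext_weight (with_infty M (n - k)) = tv * code_weight tv M" if "M \<in> msets_of_size {..K} k" for M
      proof -
        have "M \<noteq> {#}" using that False by (auto simp: msets_of_size_def)
        then obtain x where "x \<in># M" by (rule multiset_nonemptyE)
        then have "enat x \<in># with_infty M (n - k)" by (simp add: with_infty_def)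
        then show ?thesis by (auto simp: ext_weight_def)
      qed
      then have "(\<Sum>M\<in>msets_of_size {..K} k. ext_weight (with_infty M (n - k)) *
          (q_binom n k * (\<Sum>w\<in>permutations_of_multiset M. qv ^ maj w)))
        = tv * (q_binom n k * (\<Sum>M\<in>msets_of_size {..K} k. code_weight tv M * (\<Sum>w\<in>permutations_of_multiset M. qv ^ maj w)))"
        by (simp add: sum_distrib_left mult_ac cong: sum.cong)
      also have "(\<Sum>M\<in>msets_of_size {..K} k. code_weight tv M * (\<Sum>w\<in>permutations_of_multiset M. qv ^ maj w)) = eulerian_A k"
      proof -
        have "k \<le> K" using k \<open>n \<le> K\<close> by simp
        show ?thesis
          unfolding eulerian_A_eq_sum_words[OF \<open>k \<le> K\<close>]
          by (rule sum_words_by_content[OF finite_atMost, symmetric])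
      qed
      finally show ?thesis using False by simp
    qed
  qed
  also have "\<dots> = binomial_eulerian n"
    by (simp add: binomial_eulerian_def sum.atMost_shift sum.atLeast1_atMost_eq sum_distrib_left)
  finally show ?thesis by (simp add: by_content sum_inv_num_eq_sum_maj)
qed

end
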